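(* Let $n\ge2$, $1<\mathscr{P}\le n-1$, $N=\binom{n}{\mathscr{P}}$, let $0\le l<k\le N$ be integers and $p,q$ constants with $p>q-l$. Let $\varphi\in C^1(\mathbb{S}^n)$ be positive and let $u\in C^3(\mathbb{S}^n)$ be a positive admissible solution of $$\frac{\sigma_k(\Lambda(\nabla^2u+uI))}{\sigma_l(\Lambda(\nabla^2u+uI))}=u^{p-1}(u^2+|\nabla u|^2)^{\frac{k+1-q}{2}}\varphi\quad\text{on }\mathbb{S}^n.$$ Then for all $x\in\mathbb{S}^n$, $$\frac{|\nabla u(x)|}{u(x)}\le\frac{1}{p-q+l}\max_{\mathbb{S}^n}\frac{|\nabla\varphi|}{\varphi}.$$
   Context: $\mathbb{S}^n$ is the unit sphere with its standard metric; $\nabla u$, $\nabla^2u$ are the gradient and covariant Hessian in a local orthonormal frame; $I$ is the identity. Let $\mathbf{I}_1,\dots,\mathbf{I}_N$ enumerate the multi-indices $1\le i_1<\dots<i_{\mathscr{P}}\le n$. For a symmetric matrix $A$ with eigenvalues $\lambda$, $\Lambda(A)=(\Lambda_{\mathbf{I}_1},\dots,\Lambda_{\mathbf{I}_N})$ with $\Lambda_{\mathbf{I}}=\lambda_{i_1}+\dots+\lambda_{i_{\mathscr{P}}}$. $\sigma_m$ is the $m$-th elementary symmetric polynomial, $\sigma_0=1$; $\Gamma_k=\{\mu\in\mathbb{R}^N:\sigma_j(\mu)>0,\ 1\le j\le k\}$. A function $u\in C^2(\mathbb{S}^n)$ is admissible if $\Lambda(\nabla^2u+uI)\in\Gamma_k$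 at every point. *)

theory Defs
  imports "HOL-Analysis.Analysis" "HOL-Computational_Algebra.Polynomial"
begin

text \<open>The sphere S^n is realised as the unit sphere  sphere 0 1  in real^'m with CARD('m) = n+1;
functions on S^n are given as functions on real^'m, required to be C^k on an open
neighbourhood of the sphere.\<close>

definition pd :: "'m::finite \<Rightarrow> (real^'m \<Rightarrow> real) \<Rightarrow> real^'m \<Rightarrow> real" where
  "pd i f x = deriv (\<lambda>t. f (x + t *\<^sub>R axis i 1)) 0"

fun Ck :: "nat \<Rightarrow> (real^'m::finite) set \<Rightarrow> (real^'m \<Rightarrow> real) \<Rightarrow> bool" where
  "Ck 0 S f = continuous_on S f"
| "Ck (Suc k) S f = (continuous_on S f \<and> (\<forall>x\<in>S. f differentiable (at x))
                      \<and> (\<forall>i. Ck k S (pd i f)))"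

definition Csphere :: "nat \<Rightarrow> (real^'m::finite \<Rightarrow> real) \<Rightarrow> bool" where
  "Csphere k f = (\<exists>S. open S \<and> sphere 0 1 \<subseteq> S \<and> Ck k S f)"

definition egrad :: "(real^'m::finite \<Rightarrow> real) \<Rightarrow> real^'m \<Rightarrow> real^'m" where
  "egrad f x = (\<chi> i. pd i f x)"

definition ehess :: "(real^'m::finite \<Rightarrow> real) \<Rightarrow> real^'m \<Rightarrow> real^'m \<Rightarrow> real^'m \<Rightarrow> real" where
  "ehess f x X Y = (\<Sum>i\<in>UNIV. \<Sum>j\<in>UNIV. X$i * Y$j * pd j (pd i f) x)"

text \<open>Spherical gradient (tangential projection) and covariant Hessian on S^n
 (Gauss formula: second fundamental form of the unit sphere).\<close>
definition sgrad :: "(real^'m::finite \<Rightarrow> real) \<Rightarrow> real^'m \<Rightarrow> real^'m" where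
  "sgrad f x = egrad f x - (egrad f x \<bullet> x) *\<^sub>R x"

definition shess :: "(real^'m::finite \<Rightarrow> real) \<Rightarrow> real^'m \<Rightarrow> real^'m \<Rightarrow> real^'m \<Rightarrow> real" where
  "shess f x X Y = ehess f x X Y - (egrad f x \<bullet> x) * (X \<bullet> Y)"

text \<open>A local orthonormal frame of the tangent space at x, indexed by 'k (CARD('k) = n).\<close>
definition frame :: "real^'m::finite \<Rightarrow> 'k::finite \<Rightarrow> real^'m" where
  "frame x = (SOME e. (\<forall>i. e i \<bullet> x = 0) \<and> (\<forall>i j. e i \<bullet> e j = (if i = j then 1 else 0)))"

definition Amat :: "(real^'m::finite \<Rightarrow> real) \<Rightarrow> real^'m \<Rightarrow> real^'k::finite^'k" where
  "Amat f x = (\<chi> i j. shess f x (frame x i) (frame x j) + (if i = j then f x else 0))"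

definition char_poly :: "real^'k::finite^'k \<Rightarrow> real poly" where
  "char_poly A = det (\<chi> i j. (if i = j then [:0, 1:] else 0) - [:A$i$j:])"

definition eigs :: "real^'k::finite^'k \<Rightarrow> 'k \<Rightarrow> real" where
  "eigs A = (SOME lam. char_poly A = (\<Prod>i\<in>UNIV. [:- lam i, 1:]))"

definition multi_idx :: "nat \<Rightarrow> 'k::finite set set" where
  "multi_idx P = {I. card I = P}"

definition Lam :: "nat \<Rightarrow> real^'k::finite^'k \<Rightarrow> 'k set \<Rightarrow> real" where
  "Lam P A I = (\<Sum>i\<in>I. eigs A i)"

definition esym :: "nat \<Rightarrow> 'a set \<Rightarrow> ('a \<Rightarrow> real) \<Rightarrow> real" where
  "esym m J mu = (\<Sum>S\<in>{S. S \<subseteq> J \<and> card S = m}. \<Prod>s\<in>S. mu s)"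

definition Gamma_cone :: "nat \<Rightarrow> 'a set \<Rightarrow> ('a \<Rightarrow> real) \<Rightarrow> bool" where
  "Gamma_cone k J mu = (\<forall>j\<in>{1..k}. esym j J mu > 0)"

definition sigmaL :: "nat \<Rightarrow> nat \<Rightarrow> real^'k::finite^'k \<Rightarrow> real" where
  "sigmaL P m A = esym m (multi_idx P) (Lam P A)"

definition admissible :: "'k::finite itself \<Rightarrow> nat \<Rightarrow> nat \<Rightarrow> (real^'m::finite \<Rightarrow> real) \<Rightarrow> bool" where
  "admissible _ P k u = (\<forall>x\<in>sphere 0 1.
      Gamma_cone k (multi_idx P :: 'k set set) (Lam P (Amat u x :: real^'k^'k)))"

end

theory Submission
  imports Defs "HOL-Computational_Algebra.Fundamental_Theorem_Algebra"
begin

text \<open>Let \<open>R\<close> be a rotation of the sphere and let \<open>x\<close> maximise \<open>u (R y) / u y\<close>, with maximum \<open>c\<close>.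
  At \<open>x\<close> the gradients satisfy \<open>\<nabla>u(R x) = c R \<nabla>u(x)\<close> and, after identifying tangent spaces by
  \<open>R\<close>, the matrix \<open>\<nabla>\<^sup>2u + u I\<close> at \<open>R x\<close> is at most \<open>c\<close> times the one at \<open>x\<close>. Since
  \<open>\<sigma>\<^sub>k / \<sigma>\<^sub>l\<close> is monotone on \<open>\<Gamma>\<^sub>k\<close> and homogeneous of degree \<open>k - l\<close>, comparing the equation at
  the two points gives \<open>(p - q + l) ln c \<le> ln (\<phi>(x) / \<phi>(R x))\<close>. For the rotation by the angle \<open>t\<close> in
  a plane the right-hand side is at most \<open>t max |\<nabla>\<phi>| / \<phi>\<close>, so \<open>ln u\<close> is Lipschitz with the required
  constant. The equation is never differentiated.\<close>

section \<open>Newton's inequality\<close>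

text \<open>The obstacle is that \<open>sigmaL\<close> is awkward to differentiate:
  \<open>eigs\<close> lists roots in an arbitrarily chosen order, and \<open>frame\<close> is an
  arbitrary choice at every point. Comparing two matrices needs no smooth dependence on either,
  since frames enter only through an orthogonal map \<open>Q\<close> and eigenvalues only through a
  bijection. Rotations are used because an isometry makes covariant Hessians at \<open>x\<close> and
  \<open>R x\<close> comparable. Origin of the constant: when u and |grad u| are multiplied by c,
  the right-hand side of the equation gains the exponent (p - 1) + (k + 1 - q), while the left-hand
  side gains at most k - l. The difference is p - q + l, and its positivity turns the comparison
  into an upper bound for c. Monotonicity of the quotient rests on Newton's inequality. Vectors in
  the cone may have negative entries, so the inequality is derived for arbitrary real entries, from
  the real-rootedness of the product of the factors 1 + mu X.\<close>

definition real_rooted :: "complex poly \<Rightarrow> bool" where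
  "real_rooted p \<longleftrightarrow> (\<exists>c::real. \<exists>rs::real list.
     p = smult (of_real c) (\<Prod>r\<leftarrow>rs. [:- of_real r, 1:]))"

lemma real_rooted_mult:
  assumes "real_rooted p" "real_rooted q" shows "real_rooted (p * q)"
proof -
  obtain c rs where p: "p = smult (of_real c) (\<Prod>r\<leftarrow>rs. [:- of_real r, 1:])"
    using assms(1) unfolding real_rooted_def by blast
  obtain d ss where q: "q = smult (of_real d) (\<Prod>r\<leftarrow>ss. [:- of_real r, 1:])"
    using assms(2) unfolding real_rooted_def by blast
  have "p * q = smult (of_real (c * d)) (\<Prod>r\<leftarrow>rs @ ss. [:- of_real r, 1:])"
    unfolding p q by (simp add: mult.commute)
  then show ?thesis unfolding real_rooted_def by blast
qed

lemma real_rooted_linear: "real_rooted [:1, of_real m:]"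
proof (cases "m = 0")
  case True
  then have "[:1, of_real m:] = smult (of_real 1) (\<Prod>r\<leftarrow>[]. [:- of_real r, 1:])"
    by (simp add: one_pCons)
  then show ?thesis unfolding real_rooted_def by blast
next
  case False
  then have "[:1, of_real m:] = smult (of_real m) (\<Prod>r\<leftarrow>[- 1 / m]. [:- of_real r, 1:])"
    by (simp flip: of_real_mult)
  then show ?thesis unfolding real_rooted_def by blast
qed

lemma real_rooted_prod:
  assumes "finite J" shows "real_rooted (\<Prod>s\<in>J. [:1, of_real (mu s):])"
  using assms
proof (induction J rule: finite_induct)
  case empty
  then show ?case using real_rooted_linear[of 0] by (simp add: one_pCons)
next
  case (insert x F)
  then show ?case unfolding prod.insert[OF insert.hyps] by (intro real_rooted_mult real_rooted_linear)
qed

text \<open>Each summand \<open>1 / (z - r)\<close> has imaginary part -Im z / |z - r|^2; the factor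
  \<open>Im z\<close> treats both half-planes at once, and a non-empty list makes the inequality
  strict.\<close>

lemma Im_logderiv_neg:
  fixes rs :: "real list" and z :: complex
  assumes "Im z \<noteq> 0" "rs \<noteq> []"
  defines "f \<equiv> (\<Prod>r\<leftarrow>rs. [:- of_real r, 1:])"
  shows "poly f z \<noteq> 0 \<and> Im (poly (pderiv f) z / poly f z) * Im z < 0"
  unfolding f_def using assms(2)
proof (induction rs)
  case Nil
  then show ?case by simp
next
  case (Cons r rs)
  let ?g = "(\<Prod>r\<leftarrow>rs. [:- of_real r, 1:]) :: complex poly"
  have nz: "z - of_real r \<noteq> 0" using assms(1) by (auto simp: complex_eq_iff)
  have inv: "Im (1 / (z - of_real r)) * Im z < 0"
  proof -
    have "(Re z - r)\<^sup>2 + (Im z)\<^sup>2 > 0" "(Im z)\<^sup>2 > 0"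
      using assms(1) by (auto simp: sum_power2_gt_zero_iff)
    then have "(Im z)\<^sup>2 / ((Re z - r)\<^sup>2 + (Im z)\<^sup>2) > 0" by simp
    then show ?thesis by (simp add: Im_divide power2_eq_square)
  qed
  show ?case
  proof (cases "rs = []")
    case True
    then show ?thesis using nz inv by (simp add: pderiv_pCons)
  next
    case False
    with Cons.IH have gz: "poly ?g z \<noteq> 0"
      and im: "Im (poly (pderiv ?g) z / poly ?g z) * Im z < 0" by auto
    have "poly (pderiv ([:- of_real r, 1:] * ?g)) z / poly ([:- of_real r, 1:] * ?g) z
        = 1 / (z - of_real r) + poly (pderiv ?g) z / poly ?g z"
      using gz nz unfolding pderiv_mult by (simp add: pderiv_pCons field_simps)
    then have "Im (poly (pderiv ([:- of_real r, 1:] * ?g)) z / poly ([:- of_real r, 1:] * ?g) z)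
        = Im (1 / (z - of_real r)) + Im (poly (pderiv ?g) z / poly ?g z)"
      by (simp only: plus_complex.sel)
    with im inv have "Im (poly (pderiv ([:- of_real r, 1:] * ?g)) z
        / poly ([:- of_real r, 1:] * ?g) z) * Im z < 0"
      by (simp only: distrib_right add_neg_neg)
    moreover have "poly ([:- of_real r, 1:] * ?g) z \<noteq> 0" using gz nz by simp
    ultimately show ?thesis by (simp only: list.map prod_list.Cons simp_thms)
  qed
qed

text \<open>Gauss--Lucas: a non-real zero of the derivative would make the logarithmic derivative
  \<open>\<Sum> 1 / (z - r)\<close> vanish, but all its summands have imaginary part of the same sign.\<close>

lemma real_rooted_pderiv:
  assumes "real_rooted p" shows "real_rooted (pderiv p)"
proof -
  obtain c rs where p: "p = smult (of_real c) (\<Prod>r\<leftarrow>rs. [:- of_real r, 1:])"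
    using assms(1) unfolding real_rooted_def by blast
  let ?f = "(\<Prod>r\<leftarrow>rs. [:- of_real r, 1:]) :: complex poly"
  show ?thesis
  proof (cases "c = 0 \<or> rs = []")
    \<comment> \<open>Here the derivative is the zero polynomial, which counts as real-rooted
      through the scalar \<open>c = 0\<close>.\<close>
    case True
    then have "pderiv p = smult (of_real 0) (\<Prod>r\<leftarrow>[]. [:- of_real r, 1:])"
      unfolding p by auto
    then show ?thesis unfolding real_rooted_def by blast
  next
    case False
    have real: "Im z = 0" if "poly (pderiv p) z = 0" for z
    proof (rule ccontr)
      assume "Im z \<noteq> 0"
      with Im_logderiv_neg[of z rs] False have "Im (poly (pderiv ?f) z / poly ?f z) * Im z < 0"
        by blast
      moreover have "poly (pderiv ?f) z = 0" using that False unfolding p by (simp add: pderiv_smult)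
      ultimately show False by simp
    qed
    have lcf: "lead_coeff ?f = 1"
    proof (induction rs)
      case (Cons r rs)
      then show ?case unfolding list.map prod_list.Cons lead_coeff_mult by simp
    qed simp
    have degf: "degree ?f = length rs"
    proof (induction rs)
      case (Cons r rs)
      have "(\<Prod>r\<leftarrow>rs. [:- of_real r, 1:] :: complex poly) \<noteq> 0"
        by (auto simp: prod_list_zero_iff)
      then show ?case using Cons unfolding list.map prod_list.Cons
        by (subst degree_mult_eq) auto
    qed auto
    have degp: "degree p = length rs" "lead_coeff p = of_real c"
      using False degf lcf unfolding p by auto
    \<comment> \<open>\<open>real_rooted\<close> asks for a real scalar, so this coefficient has to
      be identified. It also shows that the derivative is not zero, so that \<open>proots\<close>
      lists its zeros.\<close>
    have lc: "lead_coeff (pderiv p) = of_real (of_nat (length rs) * c)"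
      using degp False by (simp add: coeff_pderiv degree_pderiv)
    have nz: "pderiv p \<noteq> 0" using lc False by (metis leading_coeff_0_iff mult_eq_0_iff
          of_real_eq_0_iff of_nat_eq_0_iff length_0_conv)
    obtain zs where zs: "mset zs = proots (pderiv p)" by (metis ex_mset)
    \<comment> \<open>Complex coefficients supply a full factorisation; \<open>real\<close> then
      replaces every root by its real part.\<close>
    have "pderiv p = smult (lead_coeff (pderiv p)) (\<Prod>x\<in>#proots (pderiv p). [:- x, 1:])"
      by (rule complex_poly_decompose_multiset[symmetric])
    also have "(\<Prod>x\<in>#proots (pderiv p). [:- x, 1:]) = (\<Prod>x\<leftarrow>zs. [:- x, 1:])"
      unfolding zs[symmetric] by (simp flip: mset_map prod_mset_prod_list)
    also have "\<dots> = (\<Prod>r\<leftarrow>map Re zs. [:- of_real r, 1:])"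
    proof -
      have "x = of_real (Re x)" if "x \<in> set zs" for x
      proof -
        have "x \<in># proots (pderiv p)" using that zs by (metis set_mset_mset)
        then have "poly (pderiv p) x = 0" using nz by simp
        then show ?thesis using real by (simp add: complex_eq_iff)
      qed
      then show ?thesis by (simp add: o_def cong: map_cong)
    qed
    finally show ?thesis unfolding lc real_rooted_def by blast
  qed
qed

text \<open>Away from roots this is the concavity of ln |p| along the real line. To avoid dividing
  by p(0), the factors are multiplied in one by one: the factor X - r turns the defect b^2 - a d
  into r^2 (b^2 - a d) + a^2.\<close>

lemma Laguerre_inequality:
  assumes "real_rooted p"
  shows "\<exists>a b d::real. poly p 0 = of_real a \<and> poly (pderiv p) 0 = of_real b \<and>
     poly (pderiv (pderiv p)) 0 = of_real d \<and> a * d \<le> b\<^sup>2"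
proof -
  obtain c rs where p: "p = smult (of_real c) (\<Prod>r\<leftarrow>rs. [:- of_real r, 1:])"
    using assms(1) unfolding real_rooted_def by blast
  have "\<exists>a b d::real. poly f 0 = of_real a \<and> poly (pderiv f) 0 = of_real b \<and>
     poly (pderiv (pderiv f)) 0 = of_real d \<and> a * d \<le> b\<^sup>2"
    if "f = (\<Prod>r\<leftarrow>rs. [:- of_real r, 1:])" for f :: "complex poly"
    using that
  proof (induction rs arbitrary: f)
    case Nil
    then show ?case by (auto intro!: exI[of _ 1] exI[of _ 0])
  next
    case (Cons r rs)
    define g where "g = (\<Prod>r\<leftarrow>rs. [:- of_real r, 1:] :: complex poly)"
    from Cons.IH[OF g_def] obtain a b d :: real where
      g: "poly g 0 = of_real a" "poly (pderiv g) 0 = of_real b"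
        "poly (pderiv (pderiv g)) 0 = of_real d" "a * d \<le> b\<^sup>2" by blast
    have f: "f = [:- of_real r, 1:] * g" unfolding Cons.prems g_def by simp
    have 1: "pderiv f = [:- of_real r, 1:] * pderiv g + g"
      unfolding f pderiv_mult by (simp add: pderiv_pCons)
    have 2: "pderiv (pderiv f) = [:- of_real r, 1:] * pderiv (pderiv g) + pderiv g + pderiv g"
      unfolding 1 pderiv_mult pderiv_add by (simp add: pderiv_pCons)
    have "(a - r * b)\<^sup>2 - (- r * a) * (2 * b - r * d) = r\<^sup>2 * (b\<^sup>2 - a * d) + a\<^sup>2"
      by (simp add: power2_eq_square algebra_simps)
    moreover have "\<dots> \<ge> 0" using g(4) by simp
    ultimately have "(- r * a) * (2 * b - r * d) \<le> (a - r * b)\<^sup>2" by linarith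
    moreover have "poly f 0 = of_real (- r * a)" unfolding f using g by simp
    moreover have "poly (pderiv f) 0 = of_real (a - r * b)" unfolding 1 using g by simp
    moreover have "poly (pderiv (pderiv f)) 0 = of_real (2 * b - r * d)"
      unfolding 2 using g by simp
    ultimately show ?case by blast
  qed
  from this[OF refl] obtain a b d :: real where
    f: "poly (\<Prod>r\<leftarrow>rs. [:- of_real r, 1:]) 0 = complex_of_real a"
      "poly (pderiv (\<Prod>r\<leftarrow>rs. [:- of_real r, 1:])) 0 = complex_of_real b"
      "poly (pderiv (pderiv (\<Prod>r\<leftarrow>rs. [:- of_real r, 1:]))) 0 = complex_of_real d"
      "a * d \<le> b\<^sup>2" by blast
  have "(c * a) * (c * d) \<le> (c * b)\<^sup>2"
    using mult_left_mono[OF f(4), of "c\<^sup>2"] by (simp add: power2_eq_square mult_ac)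
  moreover have "poly p 0 = of_real (c * a)" "poly (pderiv p) 0 = of_real (c * b)"
    "poly (pderiv (pderiv p)) 0 = of_real (c * d)"
    unfolding p using f by (simp_all add: pderiv_smult)
  ultimately show ?thesis by blast
qed

section \<open>Elementary symmetric sums and their generating polynomial\<close>

lemma esym_0 [simp]: "finite J \<Longrightarrow> esym 0 J mu = 1"
proof -
  assume "finite J"
  then have "{S. S \<subseteq> J \<and> card S = 0} = {{}}" by (auto dest: finite_subset)
  then show ?thesis by (simp add: esym_def)
qed

text \<open>Subsets are split by whether they contain \<open>i\<close>. Hence the sum is affine in
  \<open>mu i\<close>, the basis of the one-variable arguments below.\<close>

lemma esym_Suc_insert:
  assumes "finite J" "i \<notin> J"
  shows "esym (Suc m) (insert i J) mu = esym (Suc m) J mu + mu i * esym m J mu"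
proof -
  let ?A = "{S. S \<subseteq> J \<and> card S = Suc m}" and ?B = "{S. S \<subseteq> J \<and> card S = m}"
  have fin: "finite ?A" "finite ?B" using assms(1) by auto
  have dis: "?A \<inter> insert i ` ?B = {}" using assms(2) by auto
  have inj: "inj_on (insert i) ?B"
  proof (rule inj_onI)
    fix S T assume "S \<in> ?B" "T \<in> ?B" "insert i S = insert i T"
    then show "S = T" using assms(2) insert_ident[of i S T] by auto
  qed
  have "{S. S \<subseteq> insert i J \<and> card S = Suc m} = ?A \<union> insert i ` ?B"
  proof (intro equalityI subsetI)
    fix S assume S: "S \<in> {S. S \<subseteq> insert i J \<and> card S = Suc m}"
    show "S \<in> ?A \<union> insert i ` ?B"
    proof (cases "i \<in> S")
      case True
      have "finite S" using S assms(1) by (auto dest: finite_subset)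
      then have "card (S - {i}) = m" using S True by simp
      moreover have "S - {i} \<subseteq> J" using S by auto
      moreover have "S = insert i (S - {i})" using True by auto
      ultimately show ?thesis by blast
    qed (use S in auto)
  next
    fix S assume S: "S \<in> ?A \<union> insert i ` ?B"
    then show "S \<in> {S. S \<subseteq> insert i J \<and> card S = Suc m}"
    proof
      assume "S \<in> insert i ` ?B"
      then obtain T where T: "S = insert i T" "T \<subseteq> J" "card T = m" by auto
      then have "finite T" "i \<notin> T" using assms by (auto dest: finite_subset)
      then show ?thesis using T by auto
    qed auto
  qed
  then have "esym (Suc m) (insert i J) mu
      = (\<Sum>S\<in>?A. \<Prod>s\<in>S. mu s) + (\<Sum>S\<in>insert i ` ?B. \<Prod>s\<in>S. mu s)"
    unfolding esym_def using sum.union_disjoint[OF fin(1) finite_imageI[OF fin(2)] dis] by simp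
  also have "(\<Sum>S\<in>insert i ` ?B. \<Prod>s\<in>S. mu s) = (\<Sum>S\<in>?B. mu i * (\<Prod>s\<in>S. mu s))"
    unfolding sum.reindex[OF inj] o_def
  proof (rule sum.cong[OF refl])
    fix S assume "S \<in> ?B"
    then have "finite S" "i \<notin> S" using assms by (auto dest: finite_subset)
    then show "(\<Prod>s\<in>insert i S. mu s) = mu i * (\<Prod>s\<in>S. mu s)" by simp
  qed
  finally show ?thesis by (simp add: esym_def sum_distrib_left)
qed

text \<open>With factors 1 + mu X an entry \<open>mu s = 0\<close> merely contributes a constant, so
  real-rootedness survives, and the index of a coefficient is the degree of the symmetric
  sum.\<close>

lemma coeff_prod_esym:
  assumes "finite J"
  shows "coeff (\<Prod>s\<in>J. [:1, of_real (mu s):] :: complex poly) m = of_real (esym m J mu)"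
  using assms
proof (induction J arbitrary: m rule: finite_induct)
  case empty
  show ?case
  proof (cases m)
    case (Suc k)
    have e: "{S. S \<subseteq> {} \<and> card S = Suc k} = {}" by auto
    show ?thesis using Suc by (simp add: esym_def e)
  qed simp
next
  case (insert i J)
  show ?case
  proof (cases m)
    case 0
    then show ?thesis using insert by simp
  next
    case (Suc k)
    have e: "(\<Prod>s\<in>insert i J. [:1, of_real (mu s):] :: complex poly)
       = (\<Prod>s\<in>J. [:1, of_real (mu s):]) + smult (of_real (mu i)) (pCons 0 (\<Prod>s\<in>J. [:1, of_real (mu s):]))"
      using insert.hyps by simp
    show ?thesis
      unfolding e coeff_add coeff_smult Suc coeff_pCons_Suc insert.IH
        esym_Suc_insert[OF insert.hyps] by simp
  qed
qed

text \<open>The Laguerre inequality is applied to the \<open>m\<close>-th derivative of the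
  generating polynomial, again real-rooted. Its value and first two derivatives at 0 are factorial
  multiples of three consecutive symmetric sums.\<close>

lemma Newton_inequality:
  assumes "finite J"
  shows "esym m J mu * esym (Suc (Suc m)) J mu \<le> (esym (Suc m) J mu)\<^sup>2"
proof -
  define p where "p = (\<Prod>s\<in>J. [:1, of_real (mu s):] :: complex poly)"
  have "real_rooted ((pderiv ^^ m) p)"
    by (induction m) (auto simp: p_def real_rooted_prod assms real_rooted_pderiv)
  from Laguerre_inequality[OF this] obtain a b d :: real where
    abd: "poly ((pderiv ^^ m) p) 0 = of_real a" "poly ((pderiv ^^ Suc m) p) 0 = of_real b"
     "poly ((pderiv ^^ Suc (Suc m)) p) 0 = of_real d" "a * d \<le> b\<^sup>2" by auto
  have deriv: "poly ((pderiv ^^ j) p) 0 = of_real (fact j * esym j J mu)" for j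
    unfolding poly_0_coeff_0 coeff_higher_pderiv
    by (simp add: p_def coeff_prod_esym[OF assms] flip: pochhammer_fact)
  have "a = fact m * esym m J mu" "b = fact (Suc m) * esym (Suc m) J mu"
    "d = fact (Suc (Suc m)) * esym (Suc (Suc m)) J mu"
    using abd(1-3) unfolding deriv of_real_eq_iff by simp_all
  with abd(4) have "fact m * fact (Suc (Suc m)) * (esym m J mu * esym (Suc (Suc m)) J mu)
      \<le> (fact (Suc m))\<^sup>2 * (esym (Suc m) J mu)\<^sup>2"
    by (simp only: power_mult_distrib mult_ac)
  then have "(fact m)\<^sup>2 * (real (Suc m) * (real (Suc (Suc m)) * (esym m J mu * esym (Suc (Suc m)) J mu)))
     \<le> (fact m)\<^sup>2 * (real (Suc m) * (real (Suc m) * (esym (Suc m) J mu)\<^sup>2))"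
    by (simp only: fact_Suc power2_eq_square mult_ac of_nat_mult)
  then have *: "real (Suc (Suc m)) * (esym m J mu * esym (Suc (Suc m)) J mu)
     \<le> real (Suc m) * (esym (Suc m) J mu)\<^sup>2"
    by simp
  \<comment> \<open>The factorials leave the ratio (m + 2) / (m + 1) on the left; dropping it
    weakens the inequality only if the product there is positive.\<close>
  show ?thesis
  proof (cases "esym m J mu * esym (Suc (Suc m)) J mu \<le> 0")
    case True
    then show ?thesis by (meson order_trans zero_le_power2)
  next
    case False
    then have "real (Suc m) * (esym m J mu * esym (Suc (Suc m)) J mu)
       \<le> real (Suc (Suc m)) * (esym m J mu * esym (Suc (Suc m)) J mu)"
      by (intro mult_right_mono) auto
    with * have "real (Suc m) * (esym m J mu * esym (Suc (Suc m)) J mu)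
        \<le> real (Suc m) * (esym (Suc m) J mu)\<^sup>2" by linarith
    then show ?thesis by (simp only: mult_le_cancel_left_pos of_nat_0_less_iff zero_less_Suc)
  qed
qed

section \<open>Monotonicity of Hessian quotients on the Garding cone\<close>

lemma Gamma_cone_iff:
  "finite J \<Longrightarrow> Gamma_cone k J mu \<longleftrightarrow> (\<forall>j\<le>k. esym j J mu > 0)"
  unfolding Gamma_cone_def
proof safe
  fix j assume "finite J" "\<forall>j\<in>{1..k}. esym j J mu > 0" "j \<le> k"
  then show "esym j J mu > 0" by (cases "j = 0") auto
qed auto

text \<open>The sums over \<open>J\<close> are the slopes in \<open>mu i\<close> of the sums over
  \<open>insert i J\<close>, so their positivity yields monotonicity. If a > 0 were followed by b
  \<le> 0 and then c, the inequalities b + mu i a > 0 and c + mu i b > 0 would force a c > b^2,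
  against Newton.\<close>

lemma Gamma_cone_remove:
  assumes "finite J" "i \<notin> J" "Gamma_cone (Suc k) (insert i J) mu"
  shows "Gamma_cone k J mu"
  using assms(3)
proof (induction k)
  case 0
  then show ?case by (simp add: Gamma_cone_def)
next
  case (Suc k)
  have pos: "esym j (insert i J) mu > 0" if "j \<le> Suc (Suc k)" for j
    using Suc.prems that Gamma_cone_iff[of "insert i J"] assms(1) by blast
  have "Gamma_cone (Suc k) (insert i J) mu"
    using Suc.prems by (simp add: Gamma_cone_def)
  with Suc.IH have IH: "\<forall>j\<le>k. esym j J mu > 0" using Gamma_cone_iff assms(1) by blast
  let ?a = "esym k J mu" and ?b = "esym (Suc k) J mu" and ?c = "esym (Suc (Suc k)) J mu"
  have "?b > 0"
  proof (rule ccontr)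
    assume nb: "\<not> ?b > 0"
    have a: "?a > 0" using IH by auto
    have 1: "?b + mu i * ?a > 0" and 2: "?c + mu i * ?b > 0"
      using pos[of "Suc k"] pos[of "Suc (Suc k)"] esym_Suc_insert[OF assms(1,2)] by auto
    have "?a * ?c > ?a * (- (mu i * ?b))" using a 2 by (intro mult_strict_left_mono) auto
    moreover have "?a * (- (mu i * ?b)) - ?b * ?b = (?b + mu i * ?a) * (- ?b)"
      by (simp add: algebra_simps)
    moreover have "(?b + mu i * ?a) * (- ?b) \<ge> 0" using 1 nb by (intro mult_nonneg_nonneg) auto
    ultimately have "?a * ?c > ?b\<^sup>2" by (simp add: power2_eq_square)
    with Newton_inequality[OF assms(1), of k mu] show False by simp
  qed
  with IH have "\<forall>j\<le>Suc k. esym j J mu > 0" by (auto simp: le_Suc_eq)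
  then show ?case using Gamma_cone_iff assms(1) by blast
qed

text \<open>By Newton the ratios of consecutive sums decrease; the chain compares the ratio at
  \<open>k\<close> with the one at \<open>l\<close>. The cross-multiplied form is insensitive to the
  sign of \<open>esym (Suc k) J mu\<close>, which the cone leaves open.\<close>

lemma Newton_inequality_chain:
  assumes "finite J" "Gamma_cone k J mu" "l \<le> k"
  shows "esym (Suc k) J mu * esym l J mu \<le> esym k J mu * esym (Suc l) J mu"
  using assms(3,2)
proof (induction k rule: dec_induct)
  case base
  show ?case by (simp add: mult.commute)
next
  case (step k)
  let ?e = "\<lambda>j. esym j J mu"
  have pos: "?e j > 0" if "j \<le> Suc k" for j
    using step.prems that Gamma_cone_iff assms(1) by blast
  have "Gamma_cone k J mu" using step.prems by (simp add: Gamma_cone_def)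
  then have IH: "?e (Suc k) * ?e l \<le> ?e k * ?e (Suc l)" by (rule step.IH)
  have "?e k * (?e (Suc (Suc k)) * ?e l) = (?e k * ?e (Suc (Suc k))) * ?e l" by simp
  also have "\<dots> \<le> (?e (Suc k))\<^sup>2 * ?e l"
    using Newton_inequality[OF assms(1)] pos[of l] step.hyps by (intro mult_right_mono) auto
  also have "\<dots> = ?e (Suc k) * (?e (Suc k) * ?e l)" by (simp add: power2_eq_square)
  also have "\<dots> \<le> ?e (Suc k) * (?e k * ?e (Suc l))"
    using IH pos[of "Suc k"] by (intro mult_left_mono) auto
  finally have "?e k * (?e (Suc (Suc k)) * ?e l) \<le> ?e k * (?e (Suc k) * ?e (Suc l))"
    by (simp add: mult_ac)
  then show ?case using pos[of k] by simp
qed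

lemma esym_cong: "(\<And>s. s \<in> J \<Longrightarrow> mu s = nu s) \<Longrightarrow> esym m J mu = esym m J nu"
  unfolding esym_def by (intro sum.cong prod.cong refl) auto

text \<open>In a single variable both \<open>\<sigma>\<^sub>k\<close> and \<open>\<sigma>\<^sub>l\<close> are affine, so the sign of the
  derivative of their quotient is the constant sign of a \<open>2 \<times> 2\<close> determinant.\<close>

lemma esym_quotient_mono_single:
  assumes J: "finite J" "i \<notin> J" and G: "Gamma_cone k (insert i J) mu" and "l < k"
    and eq: "\<And>s. s \<in> J \<Longrightarrow> mu s = nu s" and le: "mu i \<le> nu i"
  shows "Gamma_cone k (insert i J) nu \<and>
     esym k (insert i J) mu / esym l (insert i J) mu
       \<le> esym k (insert i J) nu / esym l (insert i J) nu"
proof -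
  obtain k' where k: "k = Suc k'" using \<open>l < k\<close> by (cases k) auto
  let ?a = "\<lambda>j. esym j J mu"
  have G': "Gamma_cone k' J mu" using Gamma_cone_remove[OF J] G k by simp
  have apos: "?a j > 0" if "j \<le> k'" for j
    using G' that Gamma_cone_iff J(1) by blast
  have mu: "esym (Suc j) (insert i J) mu = ?a (Suc j) + mu i * ?a j" for j
    by (rule esym_Suc_insert[OF J])
  have nu: "esym (Suc j) (insert i J) nu = ?a (Suc j) + nu i * ?a j" for j
    using esym_Suc_insert[OF J, of j nu] esym_cong[of J mu nu] eq by simp
  have mpos: "esym j (insert i J) mu > 0" if "j \<le> k" for j
    using G that Gamma_cone_iff[of "insert i J"] J(1) by blast
  have npos: "esym j (insert i J) nu > 0" if "j \<le> k" for j
  proof (cases j)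
    case 0
    then show ?thesis using J by simp
  next
    case (Suc j')
    have "mu i * ?a j' \<le> nu i * ?a j'"
      using le apos[of j'] that Suc k by (intro mult_right_mono) auto
    then show ?thesis using mpos[OF that] mu[of j'] nu[of j'] Suc by simp
  qed
  have "esym k (insert i J) mu * esym l (insert i J) nu
     \<le> esym k (insert i J) nu * esym l (insert i J) mu"
  proof (cases l)
    case 0
    have "mu i * ?a k' \<le> nu i * ?a k'"
      using le apos[of k'] by (intro mult_right_mono) auto
    then show ?thesis using 0 J mu nu k by simp
  next
    case (Suc l')
    \<comment> \<open>This product is exactly the difference of the cross products in the goal; its
      second factor is the determinant of the two affine functions.\<close>
    have "(nu i - mu i) * (?a k' * ?a (Suc l') - ?a (Suc k') * ?a l') \<ge> 0"
      using le Newton_inequality_chain[OF J(1) G', of l'] \<open>l < k\<close> k Suc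
      by (intro mult_nonneg_nonneg) auto
    then show ?thesis unfolding k Suc mu nu by (simp add: algebra_simps)
  qed
  moreover have "esym l (insert i J) mu > 0" "esym l (insert i J) nu > 0"
    using mpos npos \<open>l < k\<close> by auto
  ultimately have "esym k (insert i J) mu / esym l (insert i J) mu
       \<le> esym k (insert i J) nu / esym l (insert i J) nu"
    by (simp only: frac_le_eq divide_le_0_iff) (simp add: divide_le_0_iff mult_pos_pos)
  moreover have "Gamma_cone k (insert i J) nu"
    using npos by (simp add: Gamma_cone_def)
  ultimately show ?thesis by blast
qed

text \<open>The coordinates are raised from \<open>mu\<close> to \<open>nu\<close> one at a time.
  Each step also returns membership in the cone, so the mixed vector is a valid start for the next
  step.\<close>

lemma esym_quotient_mono:
  assumes "finite J" "Gamma_cone k J mu" "l < k" "\<And>s. s \<in> J \<Longrightarrow> mu s \<le> nu s"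
  shows "esym k J mu / esym l J mu \<le> esym k J nu / esym l J nu"
proof -
  have "Gamma_cone k J (\<lambda>s. if s \<in> K then nu s else mu s) \<and>
     esym k J mu / esym l J mu \<le> esym k J (\<lambda>s. if s \<in> K then nu s else mu s)
        / esym l J (\<lambda>s. if s \<in> K then nu s else mu s)"
    if "finite K" "K \<subseteq> J" for K
    using that
  proof (induction K rule: finite_induct)
    case empty
    then show ?case using assms(2) by simp
  next
    case (insert i K)
    let ?m = "\<lambda>K s. if s \<in> K then nu s else mu s"
    have Ji: "J = insert i (J - {i})" "finite (J - {i})" "i \<notin> J - {i}"
      using insert.prems assms(1) by auto
    from insert have IH: "Gamma_cone k J (?m K)"
      "esym k J mu / esym l J mu \<le> esym k J (?m K) / esym l J (?m K)" by auto
    have "Gamma_cone k (insert i (J - {i})) (?m (insert i K)) \<and>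
       esym k (insert i (J - {i})) (?m K) / esym l (insert i (J - {i})) (?m K)
       \<le> esym k (insert i (J - {i})) (?m (insert i K)) / esym l (insert i (J - {i})) (?m (insert i K))"
      using Ji IH(1) assms(3,4) insert by (intro esym_quotient_mono_single) auto
    then show ?case using IH(2) unfolding Ji(1)[symmetric] by (meson order_trans)
  qed
  from this[OF assms(1) order_refl] have
    "esym k J mu / esym l J mu \<le> esym k J (\<lambda>s. if s \<in> J then nu s else mu s)
        / esym l J (\<lambda>s. if s \<in> J then nu s else mu s)" by blast
  also have "\<dots> = esym k J nu / esym l J nu"
    by (intro arg_cong2[where f="(/)"] esym_cong) auto
  finally show ?thesis .
qed

lemma esym_scale: "esym m J (\<lambda>s. c * mu s) = c ^ m * esym m J mu"
  unfolding esym_def by (auto simp: prod.distrib sum_distrib_left intro!: sum.cong)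

text \<open>This symmetry absorbs the arbitrary order in which eigenvalues are listed.\<close>

lemma esym_reindex:
  assumes "bij_betw h J J'"
  shows "esym m J (\<lambda>s. mu (h s)) = esym m J' mu"
proof -
  have inj: "inj_on h J" and im: "h ` J = J'" using assms by (auto simp: bij_betw_def)
  have "bij_betw ((`) h) {S. S \<subseteq> J \<and> card S = m} {S. S \<subseteq> J' \<and> card S = m}"
  proof (rule bij_betw_imageI)
    show "inj_on ((`) h) {S. S \<subseteq> J \<and> card S = m}"
      by (rule inj_onI) (use inj_on_image_eq_iff[OF inj] in blast)
    show "(`) h ` {S. S \<subseteq> J \<and> card S = m} = {S. S \<subseteq> J' \<and> card S = m}"
    proof (intro equalityI subsetI)
      fix T assume T: "T \<in> {S. S \<subseteq> J' \<and> card S = m}"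
      then obtain S where S: "S \<subseteq> J" "T = h ` S" using im by (auto simp: subset_image_iff)
      then have "card S = m" using T card_image[OF inj_on_subset[OF inj S(1)]] by simp
      then show "T \<in> (`) h ` {S. S \<subseteq> J \<and> card S = m}" using S by auto
    qed (use card_image[OF inj_on_subset[OF inj]] im in auto)
  qed
  from sum.reindex_bij_betw[OF this, of "\<lambda>S. \<Prod>s\<in>S. mu s"]
  have "esym m J' mu = (\<Sum>S\<in>{S. S \<subseteq> J \<and> card S = m}. \<Prod>s\<in>h ` S. mu s)"
    by (simp add: esym_def)
  also have "\<dots> = esym m J (\<lambda>s. mu (h s))"
    unfolding esym_def
  proof (rule sum.cong[OF refl])
    fix S assume "S \<in> {S. S \<subseteq> J \<and> card S = m}"
    then have "inj_on h S" using inj by (auto intro: inj_on_subset)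
    then show "(\<Prod>s\<in>h ` S. mu s) = (\<Prod>s\<in>S. mu (h s))" by (simp add: prod.reindex)
  qed
  finally show ?thesis by simp
qed

section \<open>Eigenvalues of symmetric matrices\<close>

definition orthonormal_family :: "('k \<Rightarrow> 'a::real_inner) \<Rightarrow> bool" where
  "orthonormal_family e \<longleftrightarrow> (\<forall>i j. e i \<bullet> e j = (if i = j then 1 else 0))"

lemma orthonormal_family_inner:
  "orthonormal_family e \<Longrightarrow> e i \<bullet> e j = (if i = j then 1 else 0)"
  by (simp add: orthonormal_family_def)

lemma orthonormal_family_image:
  assumes "orthonormal_family e"
  shows "inj e" "pairwise orthogonal (e ` I)" "independent (e ` I)" "x \<in> range e \<Longrightarrow> norm x = 1"
proof -
  have ne: "e i = e j \<Longrightarrow> i = j" for i j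
    using assms by (metis orthonormal_family_inner zero_neq_one)
  then show "inj e" by (auto intro: injI)
  show orth: "pairwise orthogonal (e ` I)"
    using assms by (auto simp: pairwise_def orthogonal_def orthonormal_family_inner)
  have "0 \<notin> e ` I"
    using assms by (metis imageE inner_zero_left orthonormal_family_inner zero_neq_one)
  with orth show "independent (e ` I)" by (rule pairwise_orthogonal_independent)
  show "x \<in> range e \<Longrightarrow> norm x = 1"
    using assms by (auto simp: norm_eq_1 orthonormal_family_inner)
qed

text \<open>An independent family in \<open>S\<close> with at least \<open>dim S\<close> members
  spans it. The subspace is a parameter because both the full space and tangent hyperplanes
  occur.\<close>

lemma orthonormal_family_expand:
  fixes e :: "'k::finite \<Rightarrow> 'a::euclidean_space"
  assumes e: "orthonormal_family e" and S: "subspace S" "range e \<subseteq> S" "dim S \<le> CARD('k)" "z \<in> S"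
  shows "z = (\<Sum>i\<in>UNIV. (z \<bullet> e i) *\<^sub>R e i)"
proof -
  note im = orthonormal_family_image[OF e]
  have "card (range e) = CARD('k)" using im(1) by (simp add: card_image)
  then have "S \<subseteq> span (range e)"
    using card_ge_dim_independent[OF S(2) im(3)[of UNIV]] S(3) by simp
  then have "(\<Sum>b\<in>range e. (z \<bullet> b) *\<^sub>R b) = z"
    using im S(4) by (intro orthonormal_basis_expand) auto
  then show ?thesis using im(1) by (simp add: sum.reindex)
qed

lemma orthonormal_family_sum_inner:
  fixes e :: "'k::finite \<Rightarrow> 'a::real_inner"
  assumes "orthonormal_family e"
  shows "(\<Sum>i\<in>UNIV. a i *\<^sub>R e i) \<bullet> (\<Sum>i\<in>UNIV. b i *\<^sub>R e i) = (\<Sum>i\<in>UNIV. a i * b i)"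
  by (simp add: inner_sum_left inner_sum_right orthonormal_family_inner[OF assms] if_distrib
      sum.delta mult.commute cong: if_cong)

text \<open>First variation: moving from \<open>x\<close> along the residual w = f x - m x gains 2 t
  |w|^2 at first order, which beats the quadratic loss for small t unless w = 0.\<close>

lemma Rayleigh_maximiser_eigenvector:
  fixes f :: "'a::euclidean_space \<Rightarrow> 'a"
  assumes f: "linear f" and adj: "\<And>x y. f x \<bullet> y = x \<bullet> f y"
    and S: "subspace S" "f ` S \<subseteq> S" and x: "x \<in> S" "norm x = 1"
    and max: "\<And>y. y \<in> S \<Longrightarrow> norm y = 1 \<Longrightarrow> y \<bullet> f y \<le> x \<bullet> f x"
  shows "f x = (x \<bullet> f x) *\<^sub>R x"
proof -
  define m where "m = x \<bullet> f x"
  define w where "w = f x - m *\<^sub>R x"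
  have hom: "y \<bullet> f y \<le> m * (y \<bullet> y)" if "y \<in> S" for y
  proof (cases "y = 0")
    case True
    then show ?thesis using f by simp
  next
    case False
    let ?z = "(1 / norm y) *\<^sub>R y"
    have "?z \<bullet> f ?z \<le> m"
      unfolding m_def using False S(1) that by (intro max) (auto simp: subspace_scale)
    then have "(y \<bullet> f y) / (norm y)\<^sup>2 \<le> m"
      using f by (simp add: linear_cmul power2_eq_square)
    then show ?thesis using False by (simp add: divide_le_eq dot_square_norm)
  qed
  have wS: "w \<in> S" unfolding w_def using S x(1) by (auto simp: subspace_diff subspace_scale)
  have xx: "x \<bullet> x = 1" using x(2) by (simp add: dot_square_norm)
  \<comment> \<open>\<open>K\<close> bounds the quadratic coefficient, and the summand 1 keeps it
    positive. With t = |w|^2 / K the loss is at most half of the first-order gain.\<close>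
  define K where "K = \<bar>m * (w \<bullet> w) - w \<bullet> f w\<bar> + 1"
  have K: "K > 0" unfolding K_def by simp
  define t where "t = (w \<bullet> w) / K"
  have "(x + t *\<^sub>R w) \<bullet> f (x + t *\<^sub>R w) \<le> m * ((x + t *\<^sub>R w) \<bullet> (x + t *\<^sub>R w))"
    using S(1) x(1) wS by (intro hom) (auto simp: subspace_add subspace_scale)
  moreover have "(x + t *\<^sub>R w) \<bullet> f (x + t *\<^sub>R w) = m + 2 * t * (w \<bullet> f x) + t * t * (w \<bullet> f w)"
    using adj[of x w] f
    by (simp add: linear_add linear_cmul inner_add_left inner_add_right m_def inner_commute algebra_simps)
  moreover have "(x + t *\<^sub>R w) \<bullet> (x + t *\<^sub>R w) = 1 + 2 * t * (w \<bullet> x) + t * t * (w \<bullet> w)"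
    by (simp add: inner_add_left inner_add_right xx inner_commute algebra_simps)
  moreover have "w \<bullet> f x = w \<bullet> w + m * (w \<bullet> x)"
    by (simp add: w_def inner_diff_right)
  ultimately have "m + 2 * t * (w \<bullet> w + m * (w \<bullet> x)) + t * t * (w \<bullet> f w)
      \<le> m * (1 + 2 * t * (w \<bullet> x) + t * t * (w \<bullet> w))"
    by (simp only:)
  then have "2 * t * (w \<bullet> w) \<le> t * t * (m * (w \<bullet> w) - w \<bullet> f w)"
    by (simp add: algebra_simps)
  also have "\<dots> \<le> t * t * K" unfolding K_def by (intro mult_left_mono) auto
  also have "\<dots> = t * (w \<bullet> w)" using K by (simp add: t_def)
  finally have "t * (w \<bullet> w) \<le> 0" by simp
  then have "(w \<bullet> w) * (w \<bullet> w) \<le> 0" using K by (simp add: t_def divide_le_0_iff)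
  then have "w = 0"
    using mult_pos_pos[of "w \<bullet> w" "w \<bullet> w"] by (metis inner_gt_zero_iff not_less)
  then show ?thesis by (simp add: w_def m_def)
qed

lemma selfadjoint_eigenbasis:
  fixes f :: "'a::euclidean_space \<Rightarrow> 'a"
  assumes f: "linear f" and adj: "\<And>x y. f x \<bullet> y = x \<bullet> f y"
    and "subspace S" "f ` S \<subseteq> S"
  shows "\<exists>B\<subseteq>S. finite B \<and> card B = dim S \<and> pairwise orthogonal B \<and>
     (\<forall>b\<in>B. norm b = 1 \<and> f b = (b \<bullet> f b) *\<^sub>R b)"
  using assms(3,4)
proof (induction "dim S" arbitrary: S)
  case 0
  then show ?case by (intro exI[of _ "{}"]) auto
next
  case (Suc d)
  let ?T = "S \<inter> sphere 0 1"
  have "compact ?T" using Suc.prems(1) by (simp add: closed_subspace closed_Int_compact)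
  moreover have "?T \<noteq> {}"
  proof -
    obtain y where "y \<in> S" "y \<noteq> 0"
      using Suc.hyps(2) by (metis dim_eq_0 nat.distinct(1) subsetI singletonI)
    then have "(1 / norm y) *\<^sub>R y \<in> ?T" using Suc.prems(1) by (auto simp: subspace_scale)
    then show ?thesis by blast
  qed
  moreover have "continuous_on ?T (\<lambda>y. y \<bullet> f y)"
    using f by (intro continuous_intros linear_continuous_on linear_conv_bounded_linear[THEN iffD1])
  ultimately obtain x where x: "x \<in> ?T" "\<forall>y\<in>?T. y \<bullet> f y \<le> x \<bullet> f x"
    using continuous_attains_sup by blast
  have ev: "f x = (x \<bullet> f x) *\<^sub>R x"
    using x Suc.prems by (intro Rayleigh_maximiser_eigenvector[OF f adj, of S]) auto
  have x1: "norm x = 1" "x \<in> S" using x(1) by auto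
  define S' where "S' = {y \<in> S. \<forall>z\<in>span {x}. orthogonal z y}"
  have S'eq: "S' = {y \<in> S. x \<bullet> y = 0}"
    unfolding S'_def by (auto simp: orthogonal_def span_singleton)
  have sub: "subspace S'"
    unfolding S'eq using Suc.prems(1)
    by (auto simp: subspace_def inner_add_right)
  have inv: "f ` S' \<subseteq> S'"
  proof
    fix z assume "z \<in> f ` S'"
    then obtain y where y: "z = f y" "y \<in> S" "x \<bullet> y = 0" unfolding S'eq by auto
    have "x \<bullet> f y = (x \<bullet> f x) * (x \<bullet> y)" using adj[of x y] ev by (metis inner_scaleR_left)
    then show "z \<in> S'" using y Suc.prems(2) unfolding S'eq by auto
  qed
  have "dim S' + dim (span {x}) = dim S"
    unfolding S'_def using Suc.prems(1) x1
    by (intro dim_subspace_orthogonal_to_vectors) (auto simp: span_minimal)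
  moreover have "dim (span {x}) = 1" using x1 by (auto simp: dim_singleton)
  ultimately have "d = dim S'" using Suc.hyps(2) by simp
  from Suc.hyps(1)[OF this sub inv] obtain B where
    B: "B \<subseteq> S'" "finite B" "card B = dim S'" "pairwise orthogonal B"
      "\<forall>b\<in>B. norm b = 1 \<and> f b = (b \<bullet> f b) *\<^sub>R b" by blast
  have xB: "x \<notin> B" using B(1) x1 unfolding S'eq by (auto simp: dot_square_norm)
  show ?case
  proof (intro exI[of _ "insert x B"] conjI)
    show "insert x B \<subseteq> S" using B(1) x1 unfolding S'eq by auto
    show "card (insert x B) = dim S" using B xB \<open>d = dim S'\<close> Suc.hyps(2) by simp
    show "pairwise orthogonal (insert x B)"
      using B(1,4) unfolding pairwise_insert S'eq by (auto simp: orthogonal_def inner_commute)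
    show "\<forall>b\<in>insert x B. norm b = 1 \<and> f b = (b \<bullet> f b) *\<^sub>R b" using B(5) x1 ev by auto
  qed (use B in auto)
qed

lemma symmetric_matrix_eigenbasis:
  fixes A :: "real^'k^'k"
  assumes "transpose A = A"
  shows "\<exists>v lam. orthonormal_family (v :: 'k \<Rightarrow> real^'k) \<and> (\<forall>i. A *v v i = lam i *\<^sub>R v i)"
proof -
  have adj: "(A *v x) \<bullet> y = x \<bullet> (A *v y)" for x y
    by (metis assms dot_lmul_matrix transpose_matrix_vector)
  obtain B where B: "finite B" "card B = CARD('k)" "pairwise orthogonal B"
      "\<forall>b\<in>B. norm b = 1 \<and> A *v b = (b \<bullet> (A *v b)) *\<^sub>R b"
    using selfadjoint_eigenbasis[OF matrix_vector_mul_linear adj subspace_UNIV] by auto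
  obtain v where v: "bij_betw v (UNIV :: 'k set) B"
    using finite_same_card_bij[of "UNIV :: 'k set" B] B by auto
  have "v i \<bullet> v j = (if i = j then 1 else 0)" for i j
  proof (cases "i = j")
    case True
    then show ?thesis using v B(4) by (auto simp: bij_betw_def dot_square_norm)
  next
    case False
    then have "v i \<noteq> v j" using v by (auto simp: bij_betw_def inj_eq)
    moreover have "v i \<in> B" "v j \<in> B" using v by (auto simp: bij_betw_def)
    ultimately show ?thesis using B(3) False by (auto simp: pairwise_def orthogonal_def)
  qed
  moreover define lam where "lam i = v i \<bullet> (A *v v i)" for i
  have "A *v v i = lam i *\<^sub>R v i" for i
    using v B(4) unfolding lam_def bij_betw_def by blast
  ultimately show ?thesis unfolding orthonormal_family_def
    by (intro exI[of _ v] exI[of _ lam]) simp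
qed

lemma poly_char_poly: "poly (char_poly A) x = det (\<chi> i j. (if i = j then x else 0) - A $ i $ j)"
  unfolding char_poly_def det_def poly_sum
proof (rule sum.cong[OF refl])
  fix p assume "p \<in> {p. p permutes (UNIV :: 'a set)}"
  have "poly (of_int (sign p)) x = (of_int (sign p) :: real)"
    by (auto simp: sign_def)
  moreover have "poly ((if i = p i then [:0, 1:] else 0) - [:A $ i $ p i:]) x
      = (if i = p i then x else 0) - A $ i $ p i" for i
    by simp
  ultimately show "poly (of_int (sign p) * (\<Prod>i\<in>UNIV.
       (\<chi> i j. (if i = j then [:0, 1:] else 0) - [:A $ i $ j:]) $ i $ p i)) x
     = of_int (sign p) * (\<Prod>i\<in>UNIV. (\<chi> i j. (if i = j then x else 0) - A $ i $ j) $ i $ p i)"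
    by (simp only: poly_mult poly_prod vec_lambda_beta)
qed

text \<open>With the \<open>v i\<close> as columns of V, one has (x I - A) V = V D with D diagonal
  and det V non-zero. The polynomials agree because they agree at every x.\<close>

lemma char_poly_eigenbasis:
  fixes A :: "real^'k^'k" and v :: "'k \<Rightarrow> real^'k"
  assumes v: "orthonormal_family v" and ev: "\<And>i. A *v v i = lam i *\<^sub>R v i"
  shows "char_poly A = (\<Prod>i\<in>UNIV. [:- lam i, 1:])"
proof -
  have "poly (char_poly A) x = poly (\<Prod>i\<in>UNIV. [:- lam i, 1:]) x" for x
  proof -
    let ?V = "\<chi> i j. v j $ i" and ?X = "\<chi> i j. (if i = j then x else 0) - A $ i $ j"
    let ?D = "\<chi> i j. if i = j then x - lam i else 0"
    have "transpose ?V ** ?V = mat 1"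
      using orthonormal_family_inner[OF v]
      by (simp add: vec_eq_iff matrix_matrix_mult_def transpose_def mat_def inner_vec_def)
    then have "det (transpose ?V ** ?V) = 1" by simp
    then have nz: "det ?V \<noteq> 0" by (auto simp: det_mul)
    have "?X ** ?V = ?V ** ?D"
    proof (simp add: vec_eq_iff matrix_matrix_mult_def, intro allI)
      fix i j
      have Av: "(\<Sum>k\<in>UNIV. A $ i $ k * v j $ k) = lam j * v j $ i"
        using ev[of j] by (simp add: vec_eq_iff matrix_vector_mult_def)
      show "(\<Sum>k\<in>UNIV. ((if i = k then x else 0) - A $ i $ k) * v j $ k) =
          (\<Sum>k\<in>UNIV. v k $ i * (if k = j then x - lam k else 0))"
      proof -
        have "((if i = k then x else 0) - A $ i $ k) * v j $ k
            = (if i = k then x * v j $ k else 0) - A $ i $ k * v j $ k" for k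
          by (simp add: algebra_simps)
        then have "(\<Sum>k\<in>UNIV. ((if i = k then x else 0) - A $ i $ k) * v j $ k) = x * v j $ i - lam j * v j $ i"
          using Av by (simp only: sum_subtractf) simp
        also have "\<dots> = (\<Sum>k\<in>UNIV. if k = j then v k $ i * (x - lam k) else 0)"
          by (simp add: algebra_simps)
        finally show ?thesis by (simp add: if_distrib cong: if_cong)
      qed
    qed
    then have "det (?X ** ?V) = det (?V ** ?D)" by (rule arg_cong)
    then have "det ?X * det ?V = det ?V * det ?D" unfolding det_mul .
    then have "det ?X = det ?D" using nz by simp
    also have "\<dots> = (\<Prod>i\<in>UNIV. x - lam i)" by (subst det_diagonal) auto
    finally show ?thesis by (simp add: poly_char_poly poly_prod)
  qed
  then show ?thesis by (simp add: poly_eq_poly_eq_iff[symmetric] fun_eq_iff)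
qed

text \<open>\<open>eigs\<close> is a chosen listing of the roots. The spectral theorem shows that a
  listing exists; any two have the same multiset of values, so they differ by a permutation, which
  is applied to the eigenbasis.\<close>

lemma symmetric_matrix_eigs:
  fixes A :: "real^'k^'k"
  assumes "transpose A = A"
  shows "\<exists>v :: 'k \<Rightarrow> real^'k. orthonormal_family v \<and> (\<forall>i. A *v v i = eigs A i *\<^sub>R v i)"
proof -
  obtain v :: "'k \<Rightarrow> real^'k" and lam where v: "orthonormal_family v"
    and ev: "\<And>i. A *v v i = lam i *\<^sub>R v i"
    using symmetric_matrix_eigenbasis[OF assms] by blast
  have lam: "char_poly A = (\<Prod>i\<in>UNIV. [:- lam i, 1:])" by (rule char_poly_eigenbasis[OF v ev])
  then have eigs: "char_poly A = (\<Prod>i\<in>UNIV. [:- eigs A i, 1:])"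
    unfolding eigs_def by (rule someI[where P = "\<lambda>lam. char_poly A = (\<Prod>i\<in>UNIV. [:- lam i, 1:])"])
  have roots: "proots (\<Prod>i\<in>UNIV. [:- g i, 1:]) = image_mset g (mset_set UNIV)" for g :: "'k \<Rightarrow> real"
    by (subst proots_prod) (auto simp: sum_unfold_sum_mset)
  have "image_mset (eigs A) (mset_set UNIV) = image_mset lam (mset_set UNIV)"
    using lam eigs roots by metis
  from image_mset_eq_implies_permutes[OF finite this] obtain p where
    p: "p permutes UNIV" "\<forall>i. eigs A i = lam (p i)" by auto
  have "orthonormal_family (v \<circ> p)"
    using v permutes_inj[OF p(1)] by (auto simp: orthonormal_family_def inj_eq)
  moreover have "A *v (v \<circ> p) i = eigs A i *\<^sub>R (v \<circ> p) i" for i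
    using ev p(2) by simp
  ultimately show ?thesis by blast
qed

section \<open>Comparison of the spectra of two quadratic forms\<close>

lemma eigenbasis_quadratic_form:
  fixes A :: "real^'k^'k" and v :: "'k \<Rightarrow> real^'k"
  assumes v: "orthonormal_family v" and ev: "\<And>i. A *v v i = a i *\<^sub>R v i"
  shows "z \<bullet> (A *v z) = (\<Sum>i\<in>UNIV. a i * (z \<bullet> v i)\<^sup>2)" "z \<bullet> z = (\<Sum>i\<in>UNIV. (z \<bullet> v i)\<^sup>2)"
proof -
  have z: "z = (\<Sum>i\<in>UNIV. (z \<bullet> v i) *\<^sub>R v i)"
    by (rule orthonormal_family_expand[OF v subspace_UNIV]) auto
  have "A *v z = (\<Sum>i\<in>UNIV. (z \<bullet> v i) *\<^sub>R (A *v v i))"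
    by (subst z) (simp add: linear_sum[OF matrix_vector_mul_linear] linear_cmul[OF matrix_vector_mul_linear])
  also have "\<dots> = (\<Sum>i\<in>UNIV. (a i * (z \<bullet> v i)) *\<^sub>R v i)" by (simp add: ev mult.commute)
  finally have Az: "A *v z = \<dots>" .
  have "z \<bullet> (A *v z) = (\<Sum>i\<in>UNIV. (z \<bullet> v i) *\<^sub>R v i) \<bullet> (\<Sum>i\<in>UNIV. (a i * (z \<bullet> v i)) *\<^sub>R v i)"
    using z Az by metis
  then show "z \<bullet> (A *v z) = (\<Sum>i\<in>UNIV. a i * (z \<bullet> v i)\<^sup>2)"
    by (simp add: orthonormal_family_sum_inner[OF v] power2_eq_square mult_ac)
  have "z \<bullet> z = (\<Sum>i\<in>UNIV. (z \<bullet> v i) *\<^sub>R v i) \<bullet> (\<Sum>i\<in>UNIV. (z \<bullet> v i) *\<^sub>R v i)"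
    using z by metis
  then show "z \<bullet> z = (\<Sum>i\<in>UNIV. (z \<bullet> v i)\<^sup>2)"
    by (simp add: orthonormal_family_sum_inner[OF v] power2_eq_square)
qed

text \<open>If the counts were in the wrong order, dimension counting would give a common non-zero vector
  on which one form is at least \<open>t\<close> and the other one is below \<open>t\<close>.\<close>

lemma eigenvalue_count_mono:
  fixes A B :: "real^'k^'k" and v w :: "'k \<Rightarrow> real^'k"
  assumes v: "orthonormal_family v" "\<And>i. A *v v i = a i *\<^sub>R v i"
    and w: "orthonormal_family w" "\<And>i. B *v w i = b i *\<^sub>R w i"
    and Q: "orthogonal_transformation Q"
    and le: "\<And>y. Q y \<bullet> (A *v Q y) \<le> c * (y \<bullet> (B *v y))"
  shows "card {i. t \<le> a i} \<le> card {i. t \<le> c * b i}"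
proof (rule ccontr)
  assume neg: "\<not> ?thesis"
  let ?I = "{i. t \<le> a i}" and ?J = "{i. \<not> t \<le> c * b i}"
  have Qw: "orthonormal_family (\<lambda>i. Q (w i))"
    using w(1) Q by (simp add: orthonormal_family_def orthogonal_transformation_def)
  define U where "U = span (v ` ?I)"
  define W where "W = span ((\<lambda>i. Q (w i)) ` ?J)"
  have dU: "dim U = card ?I"
    using orthonormal_family_image[OF v(1)]
    by (simp add: U_def dim_eq_card_independent card_image inj_on_subset)
  have dW: "dim W = card ?J"
    using orthonormal_family_image[OF Qw]
    by (simp add: W_def dim_eq_card_independent card_image inj_on_subset)
  have "card ?J = CARD('k) - card {i. t \<le> c * b i}"
    unfolding Collect_neg_eq by (simp add: card_Diff_subset Compl_eq_Diff_UNIV)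
  moreover have "card {i. t \<le> c * b i} \<le> CARD('k)" by (rule card_mono) auto
  ultimately have "dim U + dim W > CARD('k)" using neg dU dW by linarith
  moreover have "dim {x + y |x y. x \<in> U \<and> y \<in> W} + dim (U \<inter> W) = dim U + dim W"
    unfolding U_def W_def by (intro dim_sums_Int subspace_span)
  moreover have "dim {x + y |x y. x \<in> U \<and> y \<in> W} \<le> CARD('k)"
    using dim_subset_UNIV[of "{x + y |x y. x \<in> U \<and> y \<in> W}"] by simp
  ultimately have "dim (U \<inter> W) \<noteq> 0" by linarith
  then obtain z where z: "z \<in> U" "z \<in> W" "z \<noteq> 0" by (auto simp: dim_eq_0)
  obtain y where y: "z = Q y" using orthogonal_transformation_surj[OF Q] by (metis surjD)
  have zv: "z \<bullet> v i = 0" if "i \<notin> ?I" for i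
  proof -
    have "orthogonal (v i) z"
      using that
      by (intro orthogonal_to_span[OF z(1)[unfolded U_def]])
        (auto simp: orthogonal_def orthonormal_family_inner[OF v(1)])
    then show ?thesis by (simp add: orthogonal_def inner_commute)
  qed
  have yw: "y \<bullet> w i = 0" if "i \<notin> ?J" for i
  proof -
    have "orthogonal (Q (w i)) z"
      using that
      by (intro orthogonal_to_span[OF z(2)[unfolded W_def]])
        (auto simp: orthogonal_def orthonormal_family_inner[OF Qw])
    then show ?thesis using Q y by (simp add: orthogonal_def orthogonal_transformation_def inner_commute)
  qed
  have yy: "y \<bullet> y = z \<bullet> z" using Q y by (simp add: orthogonal_transformation_def)
  have "t * (z \<bullet> z) = (\<Sum>i\<in>UNIV. t * (z \<bullet> v i)\<^sup>2)"
    by (simp add: eigenbasis_quadratic_form(2)[OF v] sum_distrib_left)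
  also have "\<dots> \<le> (\<Sum>i\<in>UNIV. a i * (z \<bullet> v i)\<^sup>2)"
  proof (rule sum_mono)
    fix i show "t * (z \<bullet> v i)\<^sup>2 \<le> a i * (z \<bullet> v i)\<^sup>2"
      using zv[of i] by (cases "t \<le> a i") (auto intro: mult_right_mono)
  qed
  also have "\<dots> = z \<bullet> (A *v z)" by (simp add: eigenbasis_quadratic_form(1)[OF v])
  also have "\<dots> \<le> c * (y \<bullet> (B *v y))" using le[of y] y by simp
  also have "\<dots> = (\<Sum>i\<in>UNIV. (c * b i) * (y \<bullet> w i)\<^sup>2)"
    by (simp add: eigenbasis_quadratic_form(1)[OF w] sum_distrib_left mult.assoc)
  \<comment> \<open>Strictness comes from this side: only indices in \<open>?J\<close> contribute,
    where \<open>c * b i < t\<close>, and the non-zero \<open>y\<close> has a non-zero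
    coordinate.\<close>
  also have "\<dots> < (\<Sum>i\<in>UNIV. t * (y \<bullet> w i)\<^sup>2)"
  proof (rule sum_strict_mono_ex1)
    have "(c * b i) * (y \<bullet> w i)\<^sup>2 \<le> t * (y \<bullet> w i)\<^sup>2" for i
      using yw[of i] by (cases "t \<le> c * b i") (auto intro: mult_right_mono)
    then show "\<forall>i\<in>UNIV. (c * b i) * (y \<bullet> w i)\<^sup>2 \<le> t * (y \<bullet> w i)\<^sup>2" by blast
    obtain i where i: "y \<bullet> w i \<noteq> 0"
    proof (rule ccontr)
      assume "\<not> thesis"
      then have "\<And>i. y \<bullet> w i = 0" using that by blast
      then have "y \<bullet> y = 0" by (simp add: eigenbasis_quadratic_form(2)[OF w])
      then show False using yy z(3) by simp
    qed
    then have "c * b i < t" using yw[of i] by force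
    then have "(c * b i) * (y \<bullet> w i)\<^sup>2 < t * (y \<bullet> w i)\<^sup>2"
      using i by (intro mult_strict_right_mono) auto
    then show "\<exists>i\<in>UNIV. (c * b i) * (y \<bullet> w i)\<^sup>2 < t * (y \<bullet> w i)\<^sup>2" by blast
  qed simp
  also have "\<dots> = t * (y \<bullet> y)"
    by (simp add: eigenbasis_quadratic_form(2)[OF w] sum_distrib_left)
  finally show False using yy by simp
qed

text \<open>The index types carry no order, so sorting is replaced by counts at all levels and a
  greedy matching that pairs the two maxima. For \<open>t\<close> up to the maximum of
  \<open>a\<close> both counts drop by one; above it the left-hand count is zero.\<close>

lemma dominating_bijection:
  fixes a :: "'i \<Rightarrow> real" and b :: "'j \<Rightarrow> real"
  assumes "finite X" "finite Y" "card X = card Y"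
    and "\<And>t. card {i\<in>X. t \<le> a i} \<le> card {j\<in>Y. t \<le> b j}"
  shows "\<exists>h. bij_betw h X Y \<and> (\<forall>i\<in>X. a i \<le> b (h i))"
  using assms
proof (induction "card X" arbitrary: X Y)
  case 0
  then show ?case by (auto simp: bij_betw_def)
next
  case (Suc n)
  have ne: "X \<noteq> {}" "Y \<noteq> {}" using Suc.hyps(2) Suc.prems(3) by auto
  obtain i0 where i0: "i0 \<in> X" "\<And>i. i \<in> X \<Longrightarrow> a i \<le> a i0"
    using obtains_MAX[OF Suc.prems(1) ne(1), of a] Suc.prems(1) by (metis Max_ge finite_imageI imageI)
  obtain j0 where j0: "j0 \<in> Y" "\<And>j. j \<in> Y \<Longrightarrow> b j \<le> b j0"
    using obtains_MAX[OF Suc.prems(2) ne(2), of b] Suc.prems(2) by (metis Max_ge finite_imageI imageI)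
  have le0: "a i0 \<le> b j0"
  proof -
    have "card {i\<in>X. a i0 \<le> a i} > 0" using i0 Suc.prems(1) by (auto simp: card_gt_0_iff)
    then have "{j\<in>Y. a i0 \<le> b j} \<noteq> {}" using Suc.prems(4)[of "a i0"] by (metis card.empty leD)
    then show ?thesis using j0 by force
  qed
  have "card {i\<in>X - {i0}. t \<le> a i} \<le> card {j\<in>Y - {j0}. t \<le> b j}" for t
  proof (cases "t \<le> a i0")
    case True
    have "{i\<in>X - {i0}. t \<le> a i} = {i\<in>X. t \<le> a i} - {i0}"
      "{j\<in>Y - {j0}. t \<le> b j} = {j\<in>Y. t \<le> b j} - {j0}" by auto
    moreover have "i0 \<in> {i\<in>X. t \<le> a i}" "j0 \<in> {j\<in>Y. t \<le> b j}" using True i0 j0 le0 by auto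
    ultimately show ?thesis using Suc.prems by (simp add: diff_le_mono)
  next
    case False
    then have e: "{i\<in>X - {i0}. t \<le> a i} = {}" using i0(2) by force
    show ?thesis unfolding e by simp
  qed
  moreover have "n = card (X - {i0})" "card (X - {i0}) = card (Y - {j0})"
    using Suc.hyps(2) Suc.prems i0 j0 by auto
  ultimately obtain h where h: "bij_betw h (X - {i0}) (Y - {j0})" "\<forall>i\<in>X - {i0}. a i \<le> b (h i)"
    using Suc.hyps(1)[of "X - {i0}" "Y - {j0}"] Suc.prems by auto
  have "bij_betw (h(i0 := j0)) (insert i0 (X - {i0})) (insert j0 (Y - {j0}))"
    using h(1) by (auto simp: bij_betw_def inj_on_def)
  moreover have "insert i0 (X - {i0}) = X" "insert j0 (Y - {j0}) = Y" using i0 j0 by auto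
  moreover have "\<forall>i\<in>X. a i \<le> b ((h(i0 := j0)) i)" using h(2) le0 by auto
  ultimately show ?case by metis
qed

text \<open>Weyl's monotonicity principle, with a bijection in place of an ordering of the
  eigenvalues.\<close>

lemma eigs_dominated:
  fixes A B :: "real^'k^'k"
  assumes "transpose A = A" "transpose B = B" "orthogonal_transformation Q"
    and "\<And>y. Q y \<bullet> (A *v Q y) \<le> c * (y \<bullet> (B *v y))"
  shows "\<exists>h. bij h \<and> (\<forall>i. eigs A i \<le> c * eigs B (h i))"
proof -
  obtain v where v: "orthonormal_family v" "\<And>i. A *v v i = eigs A i *\<^sub>R v i"
    using symmetric_matrix_eigs[OF assms(1)] by blast
  obtain w where w: "orthonormal_family w" "\<And>i. B *v w i = eigs B i *\<^sub>R w i"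
    using symmetric_matrix_eigs[OF assms(2)] by blast
  show ?thesis
    using dominating_bijection[of "UNIV :: 'k set" "UNIV :: 'k set" "eigs A" "\<lambda>i. c * eigs B i"]
      eigenvalue_count_mono[OF v w assms(3,4)] by simp
qed

text \<open>A bijection of indices acts on the \<open>P\<close>-element subsets, so domination
  passes from \<open>eigs\<close> to the sums \<open>Lam\<close>; homogeneity then extracts the
  powers of \<open>c\<close>.\<close>

lemma sigmaL_quotient_mono:
  fixes A B :: "real^'k^'k"
  assumes "transpose A = A" "transpose B = B" "orthogonal_transformation Q"
    and "\<And>y. Q y \<bullet> (A *v Q y) \<le> c * (y \<bullet> (B *v y))"
    and G: "Gamma_cone k (multi_idx P) (Lam P A)" and "l < k"
  shows "sigmaL P k A / sigmaL P l A \<le> (c ^ k * sigmaL P k B) / (c ^ l * sigmaL P l B)"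
proof -
  obtain h where h: "bij h" "\<And>i. eigs A i \<le> c * eigs B (h i)"
    using eigs_dominated[OF assms(1-4)] by blast
  have "inj h" using h(1) by (rule bij_is_inj)
  have Lam_h: "Lam P B (h ` I) = (\<Sum>i\<in>I. eigs B (h i))" for I
    unfolding Lam_def using \<open>inj h\<close> by (subst sum.reindex) (auto intro: inj_on_subset)
  have bij: "bij_betw ((`) h) (multi_idx P :: 'k set set) (multi_idx P)"
  proof (rule bij_betw_imageI)
    show "inj_on ((`) h) (multi_idx P)" using \<open>inj h\<close> by (auto intro!: inj_onI simp: inj_image_eq_iff)
    show "(`) h ` multi_idx P = multi_idx P"
    proof (intro equalityI subsetI)
      fix I assume I: "I \<in> (multi_idx P :: 'k set set)"
      have "I = h ` (h -` I)" using h(1) by (simp add: bij_is_surj surj_image_vimage_eq)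
      moreover have "card (h -` I) = card I"
        using h(1) by (metis \<open>inj h\<close> calculation card_image inj_on_subset subset_UNIV)
      ultimately show "I \<in> (`) h ` multi_idx P"
        using I unfolding multi_idx_def by (intro image_eqI[of _ _ "h -` I"]) simp_all
    qed (use \<open>inj h\<close> in \<open>auto simp: multi_idx_def card_image inj_on_subset\<close>)
  qed
  have "sigmaL P k A / sigmaL P l A \<le>
     esym k (multi_idx P) (\<lambda>I. c * Lam P B (h ` I)) / esym l (multi_idx P) (\<lambda>I. c * Lam P B (h ` I))"
    unfolding sigmaL_def using h(2)
    by (intro esym_quotient_mono[OF _ G \<open>l < k\<close>])
      (auto simp: Lam_h Lam_def[of P A] sum_distrib_left intro!: sum_mono)
  then show ?thesis unfolding esym_scale esym_reindex[OF bij] sigmaL_def .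
qed

section \<open>Derivatives along great circles\<close>

text \<open>\<open>pd\<close> is built on \<open>deriv\<close>, which is informative only when a
  derivative exists. Differentiability provides a linear map, and its values on the axes identify it
  with \<open>egrad\<close>.\<close>

lemma has_derivative_egrad:
  fixes f :: "real^'m \<Rightarrow> real"
  assumes "f differentiable (at x)"
  shows "(f has_derivative (\<lambda>h. egrad f x \<bullet> h)) (at x)"
proof -
  obtain D where D: "(f has_derivative D) (at x)" using assms unfolding differentiable_def by blast
  have lin: "linear D" using D by (rule has_derivative_linear)
  have pd: "pd i f x = D (axis i 1)" for i
  proof -
    have "((\<lambda>t. x + t *\<^sub>R axis i 1) has_derivative (\<lambda>t. t *\<^sub>R axis i 1)) (at (0::real))"
      by (auto intro!: derivative_eq_intros)
    moreover have "(f has_derivative D) (at (x + (0::real) *\<^sub>R axis i 1))" using D by simp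
    ultimately have "((\<lambda>t::real. f (x + t *\<^sub>R axis i 1)) has_derivative (\<lambda>t. D (t *\<^sub>R axis i 1))) (at 0)"
      by (rule has_derivative_compose)
    then have "((\<lambda>t::real. f (x + t *\<^sub>R axis i 1)) has_real_derivative D (axis i 1)) (at 0)"
      unfolding has_field_derivative_def by (simp add: linear_cmul[OF lin] mult.commute[of _ "D _"])
    then show ?thesis unfolding pd_def by (rule DERIV_imp_deriv)
  qed
  have "D h = egrad f x \<bullet> h" for h
  proof -
    have "D h = D (\<Sum>i\<in>UNIV. h $ i *\<^sub>R axis i 1)"
      using basis_expansion[of h] by (simp add: scalar_mult_eq_scaleR)
    also have "\<dots> = (\<Sum>i\<in>UNIV. h $ i * D (axis i 1))"
      by (simp add: linear_sum[OF lin] linear_cmul[OF lin])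
    finally show ?thesis by (simp add: egrad_def inner_vec_def pd mult.commute)
  qed
  then have "D = (\<lambda>h. egrad f x \<bullet> h)" by blast
  then show ?thesis using D by simp
qed

lemma has_real_derivative_along_curve:
  fixes f :: "real^'m \<Rightarrow> real"
  assumes "f differentiable (at (g s))" "(g has_vector_derivative g') (at s)"
  shows "((\<lambda>s. f (g s)) has_real_derivative egrad f (g s) \<bullet> g') (at s)"
proof -
  have "((\<lambda>s. f (g s)) has_derivative (\<lambda>t. egrad f (g s) \<bullet> (t *\<^sub>R g'))) (at s)"
    using assms(2) unfolding has_vector_derivative_def
    by (rule has_derivative_compose[where g = f]) (rule has_derivative_egrad[OF assms(1)])
  then show ?thesis unfolding has_field_derivative_def by (simp add: mult.commute[of _ "_ \<bullet> _"])
qed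

lemma has_real_derivative_pd:
  fixes f :: "real^'m \<Rightarrow> real"
  assumes "f differentiable (at (y + t *\<^sub>R axis i 1))"
  shows "((\<lambda>t. f (y + t *\<^sub>R axis i 1)) has_real_derivative pd i f (y + t *\<^sub>R axis i 1)) (at t)"
proof -
  have "((\<lambda>t. y + t *\<^sub>R axis i 1) has_vector_derivative axis i (1::real)) (at t)"
    by (auto intro!: derivative_eq_intros simp: has_vector_derivative_def)
  from has_real_derivative_along_curve[OF assms this] show ?thesis
    by (simp add: egrad_def inner_axis)
qed

section \<open>Symmetry of second partial derivatives and of the spherical Hessian\<close>

lemma Ck_Suc_imp_Ck: "Ck (Suc k) S f \<Longrightarrow> Ck k S f"
  by (induction k arbitrary: f) auto

text \<open>The second difference over a square is invariant under exchanging \<open>i\<close> and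
  \<open>j\<close>. It becomes a mixed derivative at an inner point by the mean value theorem in
  direction \<open>i\<close>, then in direction \<open>j\<close>.\<close>

lemma second_difference_mvt:
  fixes f :: "real^'m \<Rightarrow> real"
  assumes "Ck 2 S f" "0 < h"
    and S: "\<And>s t. 0 \<le> s \<Longrightarrow> s \<le> h \<Longrightarrow> 0 \<le> t \<Longrightarrow> t \<le> h \<Longrightarrow> x + s *\<^sub>R axis i 1 + t *\<^sub>R axis j 1 \<in> S"
  shows "\<exists>s t. 0 < s \<and> s < h \<and> 0 < t \<and> t < h \<and>
    f (x + h *\<^sub>R axis i 1 + h *\<^sub>R axis j 1) - f (x + h *\<^sub>R axis i 1) - f (x + h *\<^sub>R axis j 1) + f x
      = h * h * pd j (pd i f) (x + s *\<^sub>R axis i 1 + t *\<^sub>R axis j 1)"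
proof -
  let ?ei = "axis i (1::real) :: real^'m" and ?ej = "axis j (1::real) :: real^'m"
  have d1: "f differentiable (at y)" and d2: "pd i f differentiable (at y)" if "y \<in> S" for y
    using assms(1) that by (auto simp: numeral_2_eq_2)
  define g where "g s = f ((x + h *\<^sub>R ?ej) + s *\<^sub>R ?ei) - f (x + s *\<^sub>R ?ei)" for s
  have g': "(g has_real_derivative pd i f ((x + h *\<^sub>R ?ej) + s *\<^sub>R ?ei) - pd i f (x + s *\<^sub>R ?ei)) (at s)"
    if "0 \<le> s" "s \<le> h" for s
    unfolding g_def
  proof (intro DERIV_diff has_real_derivative_pd d1)
    show "x + h *\<^sub>R ?ej + s *\<^sub>R ?ei \<in> S" using S[of s h] that assms(2) by (simp add: add_ac)
    show "x + s *\<^sub>R ?ei \<in> S" using S[of s 0] that assms(2) by simp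
  qed
  obtain s where s: "0 < s" "s < h"
    "g h - g 0 = (h - 0) * (pd i f ((x + h *\<^sub>R ?ej) + s *\<^sub>R ?ei) - pd i f (x + s *\<^sub>R ?ei))"
    using MVT2[of 0 h g, OF assms(2) g'] by blast
  have k': "((\<lambda>t. pd i f ((x + s *\<^sub>R ?ei) + t *\<^sub>R ?ej)) has_real_derivative
      pd j (pd i f) ((x + s *\<^sub>R ?ei) + t *\<^sub>R ?ej)) (at t)" if "0 \<le> t" "t \<le> h" for t
    using S[of s t] that s by (intro has_real_derivative_pd d2) simp
  obtain t where t: "0 < t" "t < h"
    "pd i f ((x + s *\<^sub>R ?ei) + h *\<^sub>R ?ej) - pd i f ((x + s *\<^sub>R ?ei) + 0 *\<^sub>R ?ej)
      = (h - 0) * pd j (pd i f) ((x + s *\<^sub>R ?ei) + t *\<^sub>R ?ej)"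
    using MVT2[of 0 h, OF assms(2) k'] by blast
  have "g h - g 0 = h * h * pd j (pd i f) (x + s *\<^sub>R ?ei + t *\<^sub>R ?ej)"
    using s(3) t(3) by (simp add: add_ac)
  then show ?thesis using s t unfolding g_def by (intro exI[of _ s] exI[of _ t]) (simp add: add_ac)
qed

text \<open>Computing one second difference in both orders gives equal mixed derivatives at two
  points close to \<open>x\<close>, and continuity does the rest. The symmetry of
  \<open>Amat\<close>, hence the reality of its eigenvalues, rests on this.\<close>

lemma pd_commute:
  fixes f :: "real^'m \<Rightarrow> real"
  assumes C: "Ck 2 S f" and "open S" "x \<in> S"
  shows "pd j (pd i f) x = pd i (pd j f) x"
proof (rule ccontr)
  assume ne: "\<not> ?thesis"
  let ?ei = "axis i (1::real) :: real^'m" and ?ej = "axis j (1::real) :: real^'m"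
  \<comment> \<open>Half of the supposed gap, so that two errors below \<open>e\<close> contradict
    it.\<close>
  define e where "e = \<bar>pd j (pd i f) x - pd i (pd j f) x\<bar> / 2"
  have e: "e > 0" using ne by (simp add: e_def)
  have c: "continuous_on S (pd b (pd a f))" for a b using C by (simp add: numeral_2_eq_2)
  have "\<exists>d>0. \<forall>y. dist y x < d \<longrightarrow> dist (pd b (pd a f) y) (pd b (pd a f) x) < e" for a b
    using c[of b a] assms(2,3) e unfolding continuous_on_eq_continuous_at[OF assms(2)] continuous_at_eps_delta
    by (metis dist_norm)
  then obtain d1 d2 where d: "d1 > 0" "d2 > 0"
    "\<And>y. dist y x < d1 \<Longrightarrow> \<bar>pd j (pd i f) y - pd j (pd i f) x\<bar> < e"
    "\<And>y. dist y x < d2 \<Longrightarrow> \<bar>pd i (pd j f) y - pd i (pd j f) x\<bar> < e"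
    unfolding dist_real_def by metis
  obtain d3 where d3: "d3 > 0" "ball x d3 \<subseteq> S" using assms(2,3) open_contains_ball by blast
  \<comment> \<open>Points of the square lie within \<open>2 * h\<close> of \<open>x\<close>, so a
    third of the admissible radius is small enough.\<close>
  define h where "h = min d1 (min d2 d3) / 3"
  have h: "h > 0" using d d3 by (simp add: h_def)
  have near: "dist (x + s *\<^sub>R axis a 1 + t *\<^sub>R axis b 1) x < min d1 (min d2 d3)"
    if "0 \<le> s" "s \<le> h" "0 \<le> t" "t \<le> h" for s t and a b :: 'm
  proof -
    have "dist (x + s *\<^sub>R axis a 1 + t *\<^sub>R axis b 1) x = norm (s *\<^sub>R axis a 1 + t *\<^sub>R axis b 1 :: real^'m)"
      by (simp add: dist_norm add.assoc)
    also have "\<dots> \<le> s + t"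
      using norm_triangle_ineq[of "s *\<^sub>R axis a 1 :: real^'m" "t *\<^sub>R axis b 1"] that by simp
    also have "\<dots> < min d1 (min d2 d3)" using that h unfolding h_def by linarith
    finally show ?thesis .
  qed
  have inS: "x + s *\<^sub>R axis a 1 + t *\<^sub>R axis b 1 \<in> S"
    if "0 \<le> s" "s \<le> h" "0 \<le> t" "t \<le> h" for s t and a b :: 'm
    using near[OF that, of a b] d3(2) by (auto simp: dist_commute subset_iff)
  obtain s t where st: "0 < s" "s < h" "0 < t" "t < h"
    "f (x + h *\<^sub>R ?ei + h *\<^sub>R ?ej) - f (x + h *\<^sub>R ?ei) - f (x + h *\<^sub>R ?ej) + f x
      = h * h * pd j (pd i f) (x + s *\<^sub>R ?ei + t *\<^sub>R ?ej)"
    using second_difference_mvt[OF C h inS] by blast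
  obtain s' t' where st': "0 < s'" "s' < h" "0 < t'" "t' < h"
    "f (x + h *\<^sub>R ?ej + h *\<^sub>R ?ei) - f (x + h *\<^sub>R ?ej) - f (x + h *\<^sub>R ?ei) + f x
      = h * h * pd i (pd j f) (x + s' *\<^sub>R ?ej + t' *\<^sub>R ?ei)"
    using second_difference_mvt[OF C h inS] by blast
  have "h * h * pd j (pd i f) (x + s *\<^sub>R ?ei + t *\<^sub>R ?ej)
      = h * h * pd i (pd j f) (x + s' *\<^sub>R ?ej + t' *\<^sub>R ?ei)"
  proof -
    have "x + h *\<^sub>R ?ej + h *\<^sub>R ?ei = x + h *\<^sub>R ?ei + h *\<^sub>R ?ej" by (simp add: add_ac)
    then have "f (x + h *\<^sub>R ?ej + h *\<^sub>R ?ei) = f (x + h *\<^sub>R ?ei + h *\<^sub>R ?ej)" by (rule arg_cong)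
    then show ?thesis using st(5) st'(5) by linarith
  qed
  then have "pd j (pd i f) (x + s *\<^sub>R ?ei + t *\<^sub>R ?ej) = pd i (pd j f) (x + s' *\<^sub>R ?ej + t' *\<^sub>R ?ei)"
    using h by simp
  moreover have "\<bar>pd j (pd i f) (x + s *\<^sub>R ?ei + t *\<^sub>R ?ej) - pd j (pd i f) x\<bar> < e"
    using near[of s t i j] st by (intro d(3)) auto
  moreover have "\<bar>pd i (pd j f) (x + s' *\<^sub>R ?ej + t' *\<^sub>R ?ei) - pd i (pd j f) x\<bar> < e"
    using near[of s' t' j i] st' by (intro d(4)) auto
  moreover have "\<bar>a - b\<bar> \<le> \<bar>z - a\<bar> + \<bar>z - b\<bar>" for a b z :: real by linarith
  ultimately have "\<bar>pd j (pd i f) x - pd i (pd j f) x\<bar> < e + e"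
    by (metis add_strict_mono order_le_less_trans)
  then show False by (simp add: e_def)
qed

lemma ehess_matrix: "ehess f x X Y = X \<bullet> ((\<chi> i j. pd j (pd i f) x) *v Y)"
  by (simp add: ehess_def inner_vec_def matrix_vector_mult_def sum_distrib_left mult_ac)

lemma shess_commute:
  assumes "Ck 2 S f" "open S" "x \<in> S"
  shows "shess f x X Y = shess f x Y X"
proof -
  have "ehess f x X Y = (\<Sum>j\<in>UNIV. \<Sum>i\<in>UNIV. X $ i * Y $ j * pd j (pd i f) x)"
    unfolding ehess_def by (rule sum.swap)
  also have "\<dots> = ehess f x Y X"
    unfolding ehess_def using pd_commute[OF assms] by (intro sum.cong refl) (simp add: mult_ac)
  finally show ?thesis by (simp add: shess_def inner_commute)
qed

lemma shess_scaleR: "shess f x (t *\<^sub>R X) (t *\<^sub>R X) = t\<^sup>2 * shess f x X X"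
  by (simp add: shess_def ehess_matrix linear_cmul[OF matrix_vector_mul_linear] power2_eq_square
      algebra_simps)

lemma shess_sum:
  fixes e :: "'k::finite \<Rightarrow> real^'m"
  shows "shess f x (\<Sum>i\<in>UNIV. y i *\<^sub>R e i) (\<Sum>j\<in>UNIV. y j *\<^sub>R e j)
    = (\<Sum>i\<in>UNIV. \<Sum>j\<in>UNIV. y i * y j * shess f x (e i) (e j))"
  unfolding shess_def ehess_matrix linear_sum[OF matrix_vector_mul_linear] inner_sum_left
    inner_sum_right[of "_ *\<^sub>R _"]
  by (simp add: linear_cmul[OF matrix_vector_mul_linear] sum_distrib_left
      right_diff_distrib mult_ac flip: sum_subtractf)

section \<open>Geodesics of the sphere and the conditions at a maximum of the ratio\<close>

definition great_circle :: "real^'m \<Rightarrow> real^'m \<Rightarrow> real \<Rightarrow> real^'m" where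
  "great_circle x X s = cos s *\<^sub>R x + sin s *\<^sub>R X"

lemma great_circle_0 [simp]: "great_circle x X 0 = x"
  by (simp add: great_circle_def)

lemma great_circle_in_sphere:
  assumes "norm x = 1" "norm X = 1" "X \<bullet> x = 0"
  shows "great_circle x X s \<in> sphere 0 1"
proof -
  have "great_circle x X s \<bullet> great_circle x X s = (cos s)\<^sup>2 + (sin s)\<^sup>2"
    using assms by (simp add: great_circle_def inner_add_left inner_add_right inner_commute
        norm_eq_1 power2_eq_square)
  then show ?thesis by (simp add: norm_eq_1)
qed

lemma has_vector_derivative_great_circle:
  "(great_circle x X has_vector_derivative great_circle X (- x) s) (at s)"
  unfolding great_circle_def[abs_def]
  by (auto intro!: derivative_eq_intros simp: has_vector_derivative_def algebra_simps)

text \<open>The acceleration of a unit-speed great circle is minus its position. This produces the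
  normal-derivative term that distinguishes \<open>shess\<close> from \<open>ehess\<close>.\<close>

lemma great_circle_derivatives:
  fixes u :: "real^'m \<Rightarrow> real"
  assumes C: "Ck 2 S u" and S: "open S" "sphere 0 1 \<subseteq> S"
    and x: "norm x = 1" "norm X = 1" "X \<bullet> x = 0"
  defines "D \<equiv> (\<lambda>s. egrad u (great_circle x X s) \<bullet> great_circle X (- x) s)"
  shows "((\<lambda>s. u (great_circle x X s)) has_real_derivative D s) (at s)"
    and "D 0 = sgrad u x \<bullet> X"
    and "(D has_real_derivative shess u x X X) (at 0)"
proof -
  have inS: "great_circle x X s \<in> S" for s using great_circle_in_sphere[OF x] S(2) by blast
  have d1: "u differentiable (at y)" and d2: "pd i u differentiable (at y)" if "y \<in> S" for y i
    using C that by (auto simp: numeral_2_eq_2)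
  show "((\<lambda>s. u (great_circle x X s)) has_real_derivative D s) (at s)"
    unfolding D_def using inS
    by (intro has_real_derivative_along_curve[OF d1] has_vector_derivative_great_circle)
  show "D 0 = sgrad u x \<bullet> X"
    using x by (simp add: D_def sgrad_def inner_diff_left inner_commute[of x])
  have Deq: "D = (\<lambda>s. \<Sum>i\<in>UNIV. pd i u (great_circle x X s) * great_circle X (- x) s $ i)"
    by (simp add: D_def egrad_def inner_vec_def fun_eq_iff)
  have "((\<lambda>s. pd i u (great_circle x X s)) has_real_derivative egrad (pd i u) x \<bullet> X) (at 0)" for i
    using has_real_derivative_along_curve[OF d2[OF inS[of 0], of i] has_vector_derivative_great_circle]
    by simp
  moreover have "((\<lambda>s. great_circle X (- x) s $ i) has_real_derivative - x $ i) (at 0)" for i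
    unfolding great_circle_def by (auto intro!: derivative_eq_intros)
  ultimately have "(D has_real_derivative
     (\<Sum>i\<in>UNIV. pd i u x * (- x $ i) + (egrad (pd i u) x \<bullet> X) * X $ i)) (at 0)"
    unfolding Deq by (auto intro!: derivative_eq_intros sum.cong)
  moreover have "(\<Sum>i\<in>UNIV. pd i u x * (- x $ i) + (egrad (pd i u) x \<bullet> X) * X $ i) = shess u x X X"
    using x(2) by (simp add: shess_def ehess_def egrad_def inner_vec_def sum.distrib sum_negf
        norm_eq_1 sum_distrib_left sum_distrib_right mult_ac sum_subtractf)
  ultimately show "(D has_real_derivative shess u x X X) (at 0)" by simp
qed

text \<open>A negative \<open>l\<close> would make \<open>g'\<close> negative just to the right of
  0, and the mean value theorem would then push \<open>g\<close> below its minimum.\<close>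

lemma second_derivative_nonneg_at_min:
  fixes g :: "real \<Rightarrow> real"
  assumes g: "\<And>s. (g has_real_derivative g' s) (at s)" and g': "(g' has_real_derivative l) (at 0)"
    and min: "\<And>s. g 0 \<le> g s"
  shows "g' 0 = 0" "l \<ge> 0"
proof -
  show g0: "g' 0 = 0" using DERIV_local_min[OF g, of 1 0] min by auto
  show "l \<ge> 0"
  proof (rule ccontr)
    assume "\<not> ?thesis"
    then obtain d where d: "d > 0" "\<And>h. h > 0 \<Longrightarrow> h < d \<Longrightarrow> g' h < 0"
      using DERIV_neg_dec_right[OF g'] g0 by auto
    obtain z where "0 < z" "z < d / 2" "g (d / 2) - g 0 = (d / 2 - 0) * g' z"
      using MVT2[of 0 "d / 2" g g'] g d(1) by auto
    moreover have "g' z < 0" using calculation d by auto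
    moreover have "(d / 2 - 0) * g' z < 0" using calculation d(1) by (simp add: mult_pos_neg)
    ultimately have "g (d / 2) < g 0" by linarith
    then show False using min[of "d / 2"] by simp
  qed
qed

text \<open>The function c u(y) - u(R y) is nonnegative on the sphere and zero at \<open>x\<close>,
  so it has a minimum along every great circle through \<open>x\<close>. Since \<open>R\<close>
  carries great circles to great circles, both terms obey the same derivative formulas.\<close>

lemma ratio_maximum_conditions:
  fixes u :: "real^'m \<Rightarrow> real"
  assumes C: "Ck 2 S u" and S: "open S" "sphere 0 1 \<subseteq> S"
    and R: "orthogonal_transformation R" and x: "norm x = 1"
    and max: "\<And>y. norm y = 1 \<Longrightarrow> u (R y) \<le> c * u y" and eq: "u (R x) = c * u x"
    and X: "X \<bullet> x = 0"
  shows "sgrad u (R x) \<bullet> R X = c * (sgrad u x \<bullet> X)"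
    and "shess u (R x) (R X) (R X) \<le> c * shess u x X X"
proof -
  have lin: "linear R" using R by (simp add: orthogonal_transformation)
  have nR: "norm (R y) = norm y" and iR: "R y \<bullet> R z = y \<bullet> z" for y z
    using R by (simp_all add: orthogonal_transformation_norm orthogonal_transformation_def)
  \<comment> \<open>The great circles are set up for unit velocity; a general tangent vector follows
    by scaling, with the zero vector treated apart.\<close>
  have unit: "sgrad u (R x) \<bullet> R X = c * (sgrad u x \<bullet> X) \<and>
     shess u (R x) (R X) (R X) \<le> c * shess u x X X" if X: "norm X = 1" "X \<bullet> x = 0" for X
  proof -
    let ?D = "\<lambda>s. egrad u (great_circle x X s) \<bullet> great_circle X (- x) s"
    let ?E = "\<lambda>s. egrad u (great_circle (R x) (R X) s) \<bullet> great_circle (R X) (- R x) s"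
    have RX: "norm (R x) = 1" "norm (R X) = 1" "R X \<bullet> R x = 0" using x X nR iR by auto
    note D = great_circle_derivatives[OF C S x X] and E = great_circle_derivatives[OF C S RX]
    have gc: "great_circle (R x) (R X) s = R (great_circle x X s)" for s
      by (simp add: great_circle_def linear_add[OF lin] linear_cmul[OF lin])
    have 1: "((\<lambda>s. c * u (great_circle x X s) - u (great_circle (R x) (R X) s)) has_real_derivative
        c * ?D s - ?E s) (at s)" for s
      by (intro DERIV_diff DERIV_cmult D(1) E(1))
    have 2: "((\<lambda>s. c * ?D s - ?E s) has_real_derivative
        c * shess u x X X - shess u (R x) (R X) (R X)) (at 0)"
      by (intro DERIV_diff DERIV_cmult D(3) E(3))
    have 3: "c * u (great_circle x X 0) - u (great_circle (R x) (R X) 0)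
       \<le> c * u (great_circle x X s) - u (great_circle (R x) (R X) s)" for s
      using max[of "great_circle x X s"] great_circle_in_sphere[OF x X, of s] eq
      by (simp add: gc)
    show ?thesis
      using second_derivative_nonneg_at_min[OF 1 2 3] D(2) E(2) by simp
  qed
  show "sgrad u (R x) \<bullet> R X = c * (sgrad u x \<bullet> X)"
    and "shess u (R x) (R X) (R X) \<le> c * shess u x X X"
  proof -
    define Y where "Y = (1 / norm X) *\<^sub>R X"
    have XY: "X = norm X *\<^sub>R Y" by (simp add: Y_def)
    show "sgrad u (R x) \<bullet> R X = c * (sgrad u x \<bullet> X)"
    proof (cases "X = 0")
      case True
      then show ?thesis using lin by (simp add: linear_0)
    next
      case False
      then have "norm Y = 1" "Y \<bullet> x = 0" using X by (auto simp: Y_def)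
      from unit[OF this] show ?thesis
        by (subst (1 2) XY) (simp add: linear_cmul[OF lin])
    qed
    show "shess u (R x) (R X) (R X) \<le> c * shess u x X X"
    proof (cases "X = 0")
      case True
      then show ?thesis using lin by (simp add: linear_0 shess_def ehess_def)
    next
      case False
      then have "norm Y = 1" "Y \<bullet> x = 0" using X by (auto simp: Y_def)
      from unit[OF this] have "(norm X)\<^sup>2 * shess u (R x) (R Y) (R Y) \<le> (norm X)\<^sup>2 * (c * shess u x Y Y)"
        by (intro mult_left_mono) auto
      moreover have "shess u (R x) (R X) (R X) = (norm X)\<^sup>2 * shess u (R x) (R Y) (R Y)"
        "shess u x X X = (norm X)\<^sup>2 * shess u x Y Y"
        using XY shess_scaleR linear_cmul[OF lin] by metis+
      ultimately show ?thesis by (simp add: mult_ac)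
    qed
  qed
qed

text \<open>Pulling \<open>sgrad u (R x)\<close> back by \<open>R\<close> gives a tangent vector
  \<open>z\<close> at \<open>x\<close>. Testing \<open>grad\<close> with the difference of
  \<open>z\<close> and \<open>c *\<^sub>R sgrad u x\<close> shows that this difference
  vanishes.\<close>

lemma ratio_maximum_norm_sgrad:
  fixes u :: "real^'m \<Rightarrow> real"
  assumes R: "orthogonal_transformation R" and x: "norm x = 1" and "c \<ge> 0"
    and grad: "\<And>X. X \<bullet> x = 0 \<Longrightarrow> sgrad u (R x) \<bullet> R X = c * (sgrad u x \<bullet> X)"
  shows "norm (sgrad u (R x)) = c * norm (sgrad u x)"
proof -
  have nR: "norm (R y) = norm y" and iR: "R y \<bullet> R z = y \<bullet> z" for y z
    using R by (simp_all add: orthogonal_transformation_norm orthogonal_transformation_def)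
  have tang: "sgrad u y \<bullet> y = 0" if "norm y = 1" for y
    using that by (simp add: sgrad_def inner_diff_left norm_eq_1)
  obtain z where z: "sgrad u (R x) = R z"
    using orthogonal_transformation_surj[OF R] by (metis surjD)
  have zx: "z \<bullet> x = 0" using tang[of "R x"] z iR nR x by simp
  define d where "d = z - c *\<^sub>R sgrad u x"
  have dx: "d \<bullet> x = 0" using zx tang[OF x] by (simp add: d_def inner_diff_left)
  have "z \<bullet> d = c * (sgrad u x \<bullet> d)" using grad[OF dx] z iR by simp
  then have "d \<bullet> d = 0" by (simp add: d_def inner_diff_left)
  then have "z = c *\<^sub>R sgrad u x" by (simp add: d_def)
  then show ?thesis using z nR \<open>c \<ge> 0\<close> by simp
qed

section \<open>Tangent frames and rotations\<close>

text \<open>Makes the choice in \<open>frame\<close> meaningful: the tangent hyperplane has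
  dimension \<open>CARD('k)\<close>, so an orthonormal basis of it can be indexed by
  \<open>'k\<close>.\<close>

lemma tangent_frame_exists:
  fixes x :: "real^'m"
  assumes "CARD('m) = CARD('k::finite) + 1" "norm x = 1"
  shows "\<exists>e :: 'k \<Rightarrow> real^'m. (\<forall>i. e i \<bullet> x = 0) \<and> (\<forall>i j. e i \<bullet> e j = (if i = j then 1 else 0))"
proof -
  have x0: "x \<noteq> 0" using assms(2) by auto
  have dimT: "dim {y. x \<bullet> y = 0} = CARD('k)" using dim_hyperplane[OF x0] assms(1) by simp
  obtain B where B: "B \<subseteq> {y. x \<bullet> y = 0}" "pairwise orthogonal B" "\<And>b. b \<in> B \<Longrightarrow> norm b = 1"
    "independent B" "card B = dim {y. x \<bullet> y = 0}"
    using orthonormal_basis_subspace[OF subspace_hyperplane[of x]] by metis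
  have "finite B" using B(4) by (rule independent_imp_finite)
  then obtain e where e: "bij_betw e (UNIV :: 'k set) B"
    using finite_same_card_bij[of "UNIV :: 'k set" B] B(5) dimT by auto
  have inB: "e i \<in> B" for i using e by (auto simp: bij_betw_def)
  have "e i \<bullet> e j = (if i = j then 1 else 0)" for i j
  proof (cases "i = j")
    case True
    then show ?thesis using B(3)[OF inB] by (simp add: dot_square_norm)
  next
    case False
    then have "e i \<noteq> e j" using e by (auto simp: bij_betw_def inj_eq)
    then show ?thesis using B(2) inB False by (auto simp: pairwise_def orthogonal_def)
  qed
  moreover have "e i \<bullet> x = 0" for i using inB[of i] B(1) by (auto simp: inner_commute)
  ultimately show ?thesis by blast
qed

lemma frame_tangent_orthonormal:
  fixes x :: "real^'m"
  assumes "CARD('m) = CARD('k::finite) + 1" "norm x = 1"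
  shows "(frame x :: 'k \<Rightarrow> real^'m) i \<bullet> x = 0" "orthonormal_family (frame x :: 'k \<Rightarrow> real^'m)"
  using someI_ex[OF tangent_frame_exists[OF assms]]
  unfolding frame_def[symmetric] orthonormal_family_def by blast+

text \<open>The isometry from coordinates to the tangent space at \<open>x\<close>; through it
  \<open>Amat\<close> is read as the form \<open>shess\<close> plus the multiple \<open>u x\<close>
  of the metric.\<close>

definition frame_vector :: "real^'m \<Rightarrow> real^'k \<Rightarrow> real^'m" where
  "frame_vector x y = (\<Sum>i\<in>UNIV. y $ i *\<^sub>R frame x i)"

lemma frame_vector_tangent:
  fixes x :: "real^'m" and y :: "real^'k"
  assumes "CARD('m) = CARD('k) + 1" "norm x = 1"
  shows "frame_vector x y \<bullet> x = 0" "frame_vector x y \<bullet> frame_vector x z = y \<bullet> z"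
proof -
  note fr = frame_tangent_orthonormal[OF assms]
  show "frame_vector x y \<bullet> x = 0" by (simp add: frame_vector_def inner_sum_left fr(1))
  show "frame_vector x y \<bullet> frame_vector x z = y \<bullet> z"
    unfolding frame_vector_def orthonormal_family_sum_inner[OF fr(2)] by (simp add: inner_vec_def)
qed

lemma frame_vector_coords:
  fixes x X :: "real^'m"
  assumes "CARD('m) = CARD('k) + 1" "norm x = 1" "X \<bullet> x = 0"
  shows "frame_vector x (\<chi> i :: 'k::finite. X \<bullet> frame x i) = X"
proof -
  note fr = frame_tangent_orthonormal[OF assms(1,2)]
  have x0: "x \<noteq> 0" using assms(2) by auto
  have "X = (\<Sum>i\<in>(UNIV :: 'k set). (X \<bullet> frame x i) *\<^sub>R frame x i)"
    using assms dim_hyperplane[OF x0] fr(1)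
    by (intro orthonormal_family_expand[OF fr(2) subspace_hyperplane[of x]]) (auto simp: inner_commute)
  then show ?thesis by (simp add: frame_vector_def)
qed

lemma Amat_quadratic_form:
  fixes y :: "real^'k::finite"
  shows "y \<bullet> (Amat u x *v y) = shess u x (frame_vector x y) (frame_vector x y) + u x * (y \<bullet> y)"
proof -
  have "y \<bullet> (Amat u x *v y) = (\<Sum>i\<in>UNIV. \<Sum>j\<in>UNIV. y $ i * y $ j * shess u x (frame x i) (frame x j)
      + (if i = j then y $ i * y $ j * u x else 0))"
    by (simp add: inner_vec_def matrix_vector_mult_def Amat_def sum_distrib_left algebra_simps
        cong: if_cong) (intro sum.cong refl, auto simp: algebra_simps)
  also have "\<dots> = shess u x (frame_vector x y) (frame_vector x y) + u x * (y \<bullet> y)"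
    by (simp add: sum.distrib frame_vector_def shess_sum inner_vec_def sum_distrib_left mult_ac)
  finally show ?thesis .
qed

lemma Amat_symmetric:
  assumes "Ck 2 S u" "open S" "x \<in> S"
  shows "transpose (Amat u x :: real^'k^'k) = Amat u x"
  using shess_commute[OF assms] by (auto simp: vec_eq_iff transpose_def Amat_def)

text \<open>For orthonormal \<open>a\<close> and \<open>b\<close>, the rotation by the angle
  \<open>t\<close> in their plane that fixes the orthogonal complement. Written as a correction to
  \<open>y\<close>, it needs no basis of the complement.\<close>

definition rotation :: "real^'m \<Rightarrow> real^'m \<Rightarrow> real \<Rightarrow> real^'m \<Rightarrow> real^'m" where
  "rotation a b t y = y + ((cos t - 1) * (y \<bullet> a) - sin t * (y \<bullet> b)) *\<^sub>R a
     + (sin t * (y \<bullet> a) + (cos t - 1) * (y \<bullet> b)) *\<^sub>R b"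

lemma rotation_inner:
  assumes "norm a = 1" "norm b = 1" "a \<bullet> b = 0"
  shows "rotation a b t y \<bullet> a = cos t * (y \<bullet> a) - sin t * (y \<bullet> b)"
    "rotation a b t y \<bullet> b = sin t * (y \<bullet> a) + cos t * (y \<bullet> b)"
  using assms by (simp_all add: rotation_def inner_add_left norm_eq_1 inner_commute algebra_simps)

lemma orthogonal_transformation_rotation:
  assumes "norm a = 1" "norm b = 1" "a \<bullet> b = 0"
  shows "orthogonal_transformation (rotation a b t)"
  unfolding orthogonal_transformation_def
proof (intro conjI allI)
  show "linear (rotation a b t)"
    by (rule linearI) (simp_all add: rotation_def inner_add_left algebra_simps)
next
  fix y z
  let ?c = "cos t" and ?s = "sin t"
  have "rotation a b t y \<bullet> rotation a b t z = rotation a b t y \<bullet> z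
     + ((?c - 1) * (z \<bullet> a) - ?s * (z \<bullet> b)) * (?c * (y \<bullet> a) - ?s * (y \<bullet> b))
     + (?s * (z \<bullet> a) + (?c - 1) * (z \<bullet> b)) * (?s * (y \<bullet> a) + ?c * (y \<bullet> b))"
    by (simp only: rotation_def[of a b t z] inner_add_right inner_scaleR_right rotation_inner[OF assms])
  also have "rotation a b t y \<bullet> z = y \<bullet> z + ((?c - 1) * (y \<bullet> a) - ?s * (y \<bullet> b)) * (z \<bullet> a)
     + (?s * (y \<bullet> a) + (?c - 1) * (y \<bullet> b)) * (z \<bullet> b)"
    by (simp add: rotation_def inner_add_left inner_add_right inner_commute[of _ z])
  \<comment> \<open>Everything besides the inner product of \<open>y\<close> and \<open>z\<close>
    collects into a multiple of cos^2 + sin^2 - 1.\<close>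
  also have "\<dots> + ((?c - 1) * (z \<bullet> a) - ?s * (z \<bullet> b)) * (?c * (y \<bullet> a) - ?s * (y \<bullet> b))
     + (?s * (z \<bullet> a) + (?c - 1) * (z \<bullet> b)) * (?s * (y \<bullet> a) + ?c * (y \<bullet> b))
     = y \<bullet> z + (?c\<^sup>2 + ?s\<^sup>2 - 1) * ((y \<bullet> a) * (z \<bullet> a) + (y \<bullet> b) * (z \<bullet> b))"
    by algebra
  finally show "rotation a b t y \<bullet> rotation a b t z = y \<bullet> z" by simp
qed

lemma rotation_eq_great_circle:
  "norm a = 1 \<Longrightarrow> a \<bullet> b = 0 \<Longrightarrow> rotation a b t a = great_circle a b t"
  by (simp add: rotation_def great_circle_def norm_eq_1 algebra_simps)

lemma rotation_0 [simp]: "rotation a b 0 y = y"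
  by (simp add: rotation_def)

lemma has_vector_derivative_rotation:
  assumes "norm a = 1" "norm b = 1" "a \<bullet> b = 0"
  shows "((\<lambda>t. rotation a b t y) has_vector_derivative
    (rotation a b t y \<bullet> a) *\<^sub>R b - (rotation a b t y \<bullet> b) *\<^sub>R a) (at t)"
  unfolding rotation_inner[OF assms] unfolding rotation_def has_vector_derivative_def
  by (auto intro!: derivative_eq_intros simp: fun_eq_iff algebra_simps)

text \<open>The field is the projection of \<open>z\<close> to the plane of \<open>a\<close> and
  \<open>b\<close>, turned by a right angle. Hence orbits of the rotation on the unit sphere have
  speed at most 1.\<close>

lemma rotation_field_norm_le:
  assumes "norm a = 1" "norm b = 1" "a \<bullet> b = 0"
  shows "norm ((z \<bullet> a) *\<^sub>R b - (z \<bullet> b) *\<^sub>R a) \<le> norm z"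
proof -
  let ?r = "z - (z \<bullet> a) *\<^sub>R a - (z \<bullet> b) *\<^sub>R b"
  have "0 \<le> ?r \<bullet> ?r" by simp
  also have "\<dots> = z \<bullet> z - ((z \<bullet> a)\<^sup>2 + (z \<bullet> b)\<^sup>2)"
    using assms by (simp add: inner_diff_left inner_diff_right norm_eq_1 inner_commute
        power2_eq_square algebra_simps)
  also have "(z \<bullet> a)\<^sup>2 + (z \<bullet> b)\<^sup>2 = (norm ((z \<bullet> a) *\<^sub>R b - (z \<bullet> b) *\<^sub>R a))\<^sup>2"
    using assms unfolding power2_norm_eq_inner
    by (simp add: inner_diff_left inner_diff_right norm_eq_1 inner_commute power2_eq_square algebra_simps)
  finally have "(norm ((z \<bullet> a) *\<^sub>R b - (z \<bullet> b) *\<^sub>R a))\<^sup>2 \<le> (norm z)\<^sup>2"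
    by (simp add: power2_norm_eq_inner)
  then show ?thesis by (rule power2_le_imp_le) simp
qed

text \<open>The orbit of \<open>x\<close> has speed at most 1, so \<open>ln phi\<close> changes at
  rate at most \<open>L\<close>. The one-sided bound is obtained by showing that
  \<open>ln phi\<close> plus \<open>s * L\<close> is nondecreasing along the orbit.\<close>

lemma ln_rotation_lipschitz:
  fixes phi :: "real^'m \<Rightarrow> real"
  assumes diff: "\<And>y. norm y = 1 \<Longrightarrow> phi differentiable (at y)"
    and pos: "\<And>y. norm y = 1 \<Longrightarrow> phi y > 0"
    and L: "\<And>y. norm y = 1 \<Longrightarrow> norm (sgrad phi y) / phi y \<le> L"
    and ab: "norm a = 1" "norm b = 1" "a \<bullet> b = 0" and x: "norm x = 1" and "t \<ge> 0"
  shows "ln (phi x) - ln (phi (rotation a b t x)) \<le> t * L"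
proof -
  let ?r = "\<lambda>s. rotation a b s x"
  let ?K = "\<lambda>s. (?r s \<bullet> a) *\<^sub>R b - (?r s \<bullet> b) *\<^sub>R a"
  have nr: "norm (?r s) = 1" for s
    using orthogonal_transformation_norm[OF orthogonal_transformation_rotation[OF ab]] x by simp
  have d: "((\<lambda>s. ln (phi (?r s)) + s * L) has_real_derivative
      (egrad phi (?r s) \<bullet> ?K s) / phi (?r s) + L) (at s)" for s
    using has_real_derivative_along_curve[OF diff[OF nr] has_vector_derivative_rotation[OF ab], of s]
      pos[OF nr, of s]
    by (auto intro!: derivative_eq_intros)
  have nonneg: "(egrad phi (?r s) \<bullet> ?K s) / phi (?r s) + L \<ge> 0" for s
  proof -
    \<comment> \<open>The rotation field is orthogonal to the position, so the normal part of
      \<open>egrad\<close> drops out.\<close>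
    have "egrad phi (?r s) \<bullet> ?K s = sgrad phi (?r s) \<bullet> ?K s"
      by (simp add: sgrad_def inner_diff_left inner_diff_right inner_commute)
    moreover have "\<bar>sgrad phi (?r s) \<bullet> ?K s\<bar> \<le> norm (sgrad phi (?r s)) * norm (?K s)"
      by (rule Cauchy_Schwarz_ineq2)
    moreover have "norm (sgrad phi (?r s)) * norm (?K s) \<le> norm (sgrad phi (?r s)) * 1"
      using rotation_field_norm_le[OF ab, of "?r s"] nr by (intro mult_left_mono) auto
    ultimately have "- norm (sgrad phi (?r s)) \<le> egrad phi (?r s) \<bullet> ?K s" by linarith
    then have "- norm (sgrad phi (?r s)) / phi (?r s) \<le> (egrad phi (?r s) \<bullet> ?K s) / phi (?r s)"
      using pos[OF nr] by (intro divide_right_mono) (auto intro: less_imp_le)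
    then show ?thesis using L[OF nr, of s] by simp
  qed
  have "ln (phi (?r 0)) + 0 * L \<le> ln (phi (?r t)) + t * L"
    using d nonneg by (intro DERIV_nonneg_imp_nondecreasing[OF \<open>t \<ge> 0\<close>]) blast
  then show ?thesis by simp
qed

section \<open>The gradient estimate\<close>

lemma sigmaL_quotient_at_ratio_maximum:
  fixes u :: "real^'m \<Rightarrow> real"
  assumes card: "CARD('m) = CARD('k::finite) + 1"
    and C: "Ck 2 S u" and S: "open S" "sphere 0 1 \<subseteq> S"
    and R: "orthogonal_transformation R" and x: "norm x = 1"
    and max: "\<And>y. norm y = 1 \<Longrightarrow> u (R y) \<le> c * u y" and eq: "u (R x) = c * u x"
    and adm: "admissible TYPE('k) P k u" and "l < k"
  shows "sigmaL P k (Amat u (R x) :: real^'k^'k) / sigmaL P l (Amat u (R x) :: real^'k^'k)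
     \<le> (c ^ k * sigmaL P k (Amat u x :: real^'k^'k)) / (c ^ l * sigmaL P l (Amat u x :: real^'k^'k))"
proof -
  have lin: "linear R" using R by (simp add: orthogonal_transformation)
  have nR: "norm (R y) = norm y" and iR: "R y \<bullet> R z = y \<bullet> z" for y z
    using R by (simp_all add: orthogonal_transformation_norm orthogonal_transformation_def)
  have Rx: "norm (R x) = 1" using nR x by simp
  \<comment> \<open>\<open>Q\<close> expresses \<open>R\<close> in the frames of the two tangent
    spaces. The frames at \<open>x\<close> and \<open>R x\<close> are unrelated choices, so
    \<open>Q\<close> depends on both.\<close>
  define Q :: "real^'k \<Rightarrow> real^'k" where "Q y = (\<chi> i. R (frame_vector x y) \<bullet> frame (R x) i)" for y
  have fQ: "frame_vector (R x) (Q y) = R (frame_vector x y)" for y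
    unfolding Q_def using frame_vector_tangent(1)[OF card x, of y] iR
    by (intro frame_vector_coords[OF card Rx]) simp
  have "linear Q"
    by (rule linearI) (simp_all add: Q_def frame_vector_def vec_eq_iff linear_add[OF lin]
        linear_cmul[OF lin] linear_sum[OF lin] sum.distrib inner_add_left inner_sum_left
        sum_distrib_left scaleR_add_left algebra_simps)
  moreover have inner_Q: "Q y \<bullet> Q z = y \<bullet> z" for y z
    using frame_vector_tangent(2)[OF card Rx, of "Q y" "Q z"] fQ iR
      frame_vector_tangent(2)[OF card x, of y z] by simp
  ultimately have Q: "orthogonal_transformation Q" by (simp add: orthogonal_transformation_def)
  \<comment> \<open>The Hessian comparison extends to \<open>Amat\<close> because
    \<open>u (R x) = c * u x\<close> matches the zeroth-order terms exactly.\<close>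
  have le: "Q y \<bullet> (Amat u (R x) *v Q y) \<le> c * (y \<bullet> (Amat u x *v y))" for y :: "real^'k"
    using ratio_maximum_conditions(2)[OF C S R x max eq frame_vector_tangent(1)[OF card x, of y]]
    by (simp add: Amat_quadratic_form fQ inner_Q eq algebra_simps)
  have "Gamma_cone k (multi_idx P :: 'k set set) (Lam P (Amat u (R x) :: real^'k^'k))"
    using adm Rx by (simp add: admissible_def)
  then show ?thesis
    using S(2) x Rx
    by (intro sigmaL_quotient_mono[OF _ _ Q le _ \<open>l < k\<close>] Amat_symmetric[OF C S(1)]) auto
qed

text \<open>Comparing the equation at \<open>x\<close> and \<open>R x\<close>, with \<open>x\<close>
  a maximum of the ratio, bounds \<open>ln c\<close>. Since \<open>c\<close> is the largest ratio
  and p - q + l is positive, the bound passes to the ratio at every \<open>y\<close>.\<close>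

lemma ln_ratio_le:
  fixes u phi :: "real^'m \<Rightarrow> real" and p q :: real
  assumes card: "CARD('m) = CARD('k::finite) + 1" and "l < k" and pq: "p > q - real l"
    and phi: "\<And>y. norm y = 1 \<Longrightarrow> phi y > 0"
    and C: "Ck 2 S u" and S: "open S" "sphere 0 1 \<subseteq> S" and u: "\<And>y. norm y = 1 \<Longrightarrow> u y > 0"
    and adm: "admissible TYPE('k) P k u"
    and eq: "\<And>x. norm x = 1 \<Longrightarrow>
       sigmaL P k (Amat u x :: real^'k^'k) / sigmaL P l (Amat u x :: real^'k^'k)
         = u x powr (p - 1) * ((u x)\<^sup>2 + (norm (sgrad u x))\<^sup>2) powr ((real k + 1 - q) / 2) * phi x"
    and R: "orthogonal_transformation R"
    and M: "\<And>y. norm y = 1 \<Longrightarrow> ln (phi y) - ln (phi (R y)) \<le> M"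
    and y: "norm y = 1"
  shows "(p - q + real l) * (ln (u (R y)) - ln (u y)) \<le> M"
proof -
  have nR: "norm (R y) = norm y" for y using R by (simp add: orthogonal_transformation_norm)
  have cu: "continuous_on (sphere 0 1) u"
    using C S(2) by (auto simp: numeral_2_eq_2 intro: continuous_on_subset)
  have cR: "continuous_on (sphere 0 1) R"
    using R by (simp add: orthogonal_transformation linear_continuous_on linear_conv_bounded_linear)
  have "continuous_on (sphere 0 1) (\<lambda>y. u (R y) / u y)"
  proof (intro continuous_on_divide cu)
    show "continuous_on (sphere 0 1) (\<lambda>y. u (R y))"
      using nR by (intro continuous_on_compose2[OF cu cR]) auto
    show "\<forall>y\<in>sphere 0 1. u y \<noteq> 0" using u by force
  qed
  moreover have "(sphere 0 1 :: (real^'m) set) \<noteq> {}" using y by auto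
  ultimately obtain x where x: "norm x = 1"
    and mx: "\<And>y. norm y = 1 \<Longrightarrow> u (R y) / u y \<le> u (R x) / u x"
    using continuous_attains_sup[OF compact_sphere, of 0 1 "\<lambda>y. u (R y) / u y"] by auto
  define c where "c = u (R x) / u x"
  have ux: "u x > 0" and uRx: "u (R x) > 0" using u x nR by auto
  have c: "c > 0" using ux uRx by (simp add: c_def)
  have max: "u (R y) \<le> c * u y" if "norm y = 1" for y
    using mx[OF that] u[OF that] by (simp add: c_def divide_le_eq)
  have eqx: "u (R x) = c * u x" using ux by (simp add: c_def)
  have Rx: "norm (R x) = 1" using nR x by simp
  define G where "G = norm (sgrad u x)"
  have grad: "norm (sgrad u (R x)) = c * G"
    unfolding G_def using c
    by (intro ratio_maximum_norm_sgrad[OF R x] ratio_maximum_conditions(1)[OF C S R x max eqx]) auto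
  define e where "e = (real k + 1 - q) / 2"
  define F where "F z = sigmaL P k (Amat u z :: real^'k^'k) / sigmaL P l (Amat u z :: real^'k^'k)" for z
  define V where "V = (u x)\<^sup>2 + G\<^sup>2"
  have V: "V > 0" using ux by (simp add: V_def add_pos_nonneg)
  have Fx: "F x = u x powr (p - 1) * V powr e * phi x"
    unfolding F_def V_def G_def e_def by (rule eq[OF x])
  have "(u (R x))\<^sup>2 + (norm (sgrad u (R x)))\<^sup>2 = c\<^sup>2 * V"
    by (simp add: eqx grad V_def power_mult_distrib algebra_simps)
  then have FRx: "F (R x) = (c * u x) powr (p - 1) * (c\<^sup>2 * V) powr e * phi (R x)"
    using eq[OF Rx] eqx by (simp add: F_def e_def)
  \<comment> \<open>Positivity is read off the right-hand side of the equation and permits taking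
    logarithms.\<close>
  have pos: "F x > 0" "F (R x) > 0"
    unfolding Fx FRx using c ux V phi[OF x] phi[OF Rx] by simp_all
  have "F (R x) \<le> (c ^ k / c ^ l) * F x"
    using sigmaL_quotient_at_ratio_maximum[OF card C S R x max eqx adm \<open>l < k\<close>] by (simp add: F_def)
  then have "ln (F (R x)) \<le> ln ((c ^ k / c ^ l) * F x)"
    using pos c by (simp add: ln_le_cancel_iff)
  also have "\<dots> = (real k - real l) * ln c + ln (F x)"
    using pos c by (simp add: ln_mult ln_div ln_realpow algebra_simps)
  also have "ln (F x) = (p - 1) * ln (u x) + e * ln V + ln (phi x)"
    unfolding Fx using ux V phi[OF x] by (simp add: ln_mult ln_powr)
  finally have 1: "ln (F (R x)) \<le> (real k - real l) * ln c + ((p - 1) * ln (u x) + e * ln V + ln (phi x))" .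
  have "ln (F (R x)) = (p - 1) * (ln c + ln (u x)) + e * (2 * ln c + ln V) + ln (phi (R x))"
    unfolding FRx using c ux V phi[OF Rx] by (simp add: ln_mult ln_powr ln_realpow)
  also have "e * (2 * ln c + ln V) = (real k + 1 - q) * ln c + e * ln V"
    by (simp add: e_def field_simps)
  finally have "(p - q + real l) * ln c \<le> ln (phi x) - ln (phi (R x))"
    using 1 by (simp add: algebra_simps)
  also have "\<dots> \<le> M" by (rule M[OF x])
  finally have *: "(p - q + real l) * ln c \<le> M" .
  have uy: "u y > 0" "u (R y) > 0" using u y nR by auto
  have "ln (u (R y)) \<le> ln (c * u y)" using max[OF y] uy c by (simp add: ln_le_cancel_iff)
  then have "ln (u (R y)) - ln (u y) \<le> ln c" using c uy by (simp add: ln_mult)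
  then have "(p - q + real l) * (ln (u (R y)) - ln (u y)) \<le> (p - q + real l) * ln c"
    using pq by (intro mult_left_mono) auto
  with * show ?thesis by linarith
qed

theorem theorem4p2:
  fixes n P k l :: nat and p q :: real
    and u phi :: "real^'m::finite \<Rightarrow> real"
  assumes dim: "CARD('k::finite) = n" "CARD('m) = n + 1" "n \<ge> 2"
    and P: "1 < P" "P \<le> n - 1"
    and kl: "l < k" "k \<le> n choose P"
    and pq: "p > q - real l"
    and phi: "Csphere 1 phi" "\<forall>x\<in>sphere 0 1. phi x > 0"
    and u: "Csphere 3 u" "\<forall>x\<in>sphere 0 1. u x > 0"
    and adm: "admissible TYPE('k) P k u"
    and eq: "\<forall>x\<in>sphere 0 1.
       sigmaL P k (Amat u x :: real^'k^'k) / sigmaL P l (Amat u x :: real^'k^'k)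
         = u x powr (p - 1) * ((u x)\<^sup>2 + (norm (sgrad u x))\<^sup>2) powr ((real k + 1 - q) / 2) * phi x"
  shows "\<forall>x\<in>sphere 0 1. norm (sgrad u x) / u x
           \<le> 1 / (p - q + real l) * (SUP y\<in>sphere 0 1. norm (sgrad phi y) / phi y)"
proof
  fix x :: "real^'m" assume "x \<in> sphere 0 1"
  then have x: "norm x = 1" by simp
  obtain S where S: "open S" "sphere 0 1 \<subseteq> S" and C3: "Ck 3 S u"
    using u(1) unfolding Csphere_def by blast
  have C: "Ck 2 S u" using Ck_Suc_imp_Ck[of 2 S u] C3 by (simp add: numeral_3_eq_3 numeral_2_eq_2)
  obtain T where T: "open T" "sphere 0 1 \<subseteq> T" and C1: "Ck 1 T phi"
    using phi(1) unfolding Csphere_def by blast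
  have card: "CARD('m) = CARD('k) + 1" using dim by simp
  have phipos: "phi y > 0" and upos: "u y > 0" if "norm y = 1" for y using phi(2) u(2) that by auto
  define L where "L = (SUP y\<in>sphere 0 1. norm (sgrad phi y) / phi y)"
  \<comment> \<open>Continuity on the compact sphere bounds the set under \<open>SUP\<close>, so
    that \<open>L\<close> is an upper bound and not an unspecified value.\<close>
  have cont: "continuous_on (sphere 0 1) (\<lambda>y. norm (sgrad phi y) / phi y)"
  proof -
    have "continuous_on (sphere 0 1) (pd i phi)" for i
      using C1 T(2) by (auto intro: continuous_on_subset)
    then have "continuous_on (sphere 0 1) (egrad phi)"
      unfolding egrad_def by (intro continuous_on_vec_lambda)
    moreover have "continuous_on (sphere 0 1) phi"
      using C1 T(2) by (auto intro: continuous_on_subset)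
    moreover have "\<forall>y\<in>sphere 0 1. phi y \<noteq> 0" using phi(2) by force
    ultimately show ?thesis unfolding sgrad_def by (intro continuous_intros) auto
  qed
  have bdd: "bdd_above ((\<lambda>y. norm (sgrad phi y) / phi y) ` sphere 0 1)"
    using compact_continuous_image[OF cont compact_sphere]
    by (intro bounded_imp_bdd_above compact_imp_bounded)
  have L: "norm (sgrad phi y) / phi y \<le> L" if "norm y = 1" for y
    unfolding L_def using that by (intro cSUP_upper bdd) simp
  have diff: "phi differentiable (at y)" if "norm y = 1" for y
    using C1 T(2) that by (auto simp: subset_iff)
  have L0: "L \<ge> 0" using L[OF x] phipos[OF x] by (meson divide_nonneg_pos norm_ge_zero order_trans)
  have beta: "p - q + real l > 0" using pq by simp
  have "(p - q + real l) * (norm (sgrad u x) / u x) \<le> L"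
  proof (cases "sgrad u x = 0")
    case True
    then show ?thesis using L0 by simp
  next
    case False
    \<comment> \<open>The rotation plane is spanned by \<open>x\<close> and the direction of
      steepest ascent, so the derivative of \<open>ln u\<close> along the orbit at
      \<open>t = 0\<close> is \<open>norm (sgrad u x) / u x\<close>.\<close>
    define xi where "xi = (1 / norm (sgrad u x)) *\<^sub>R sgrad u x"
    have xi: "norm xi = 1" "xi \<bullet> x = 0"
      using False x by (auto simp: xi_def sgrad_def inner_diff_left norm_eq_1)
    then have xi': "x \<bullet> xi = 0" by (simp add: inner_commute)
    have sxi: "sgrad u x \<bullet> xi = norm (sgrad u x)"
      using False by (simp add: xi_def dot_square_norm power2_eq_square)
    \<comment> \<open>For \<open>t > 0\<close> the rotation estimate keeps \<open>?g\<close> at or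
      below its value at 0, so its derivative there cannot be positive; that derivative is the
      difference of the two sides of the claim.\<close>
    let ?g = "\<lambda>t. (p - q + real l) * ln (u (great_circle x xi t)) - t * L"
    have le: "?g t \<le> ?g 0" if "t > 0" for t
    proof -
      have "(p - q + real l) * (ln (u (rotation x xi t x)) - ln (u x)) \<le> t * L"
      proof (rule ln_ratio_le[OF card kl(1) pq phipos C S upos adm _
              orthogonal_transformation_rotation[OF x xi(1) xi'] _ x])
        show "ln (phi y) - ln (phi (rotation x xi t y)) \<le> t * L" if "norm y = 1" for y
          using that \<open>t > 0\<close> by (intro ln_rotation_lipschitz[OF diff phipos L x xi(1) xi']) auto
      qed (use eq in auto)
      then show ?thesis by (simp add: rotation_eq_great_circle[OF x xi'] algebra_simps)
    qed
    have "((\<lambda>t. u (great_circle x xi t)) has_real_derivative norm (sgrad u x)) (at 0)"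
      using great_circle_derivatives(1)[OF C S x xi, of 0] great_circle_derivatives(2)[OF C S x xi] sxi
      by simp
    then have "(?g has_real_derivative (p - q + real l) * (norm (sgrad u x) / u x) - L) (at 0)"
      using upos[OF x] by (auto intro!: derivative_eq_intros)
    note DERIV_pos_inc_right[OF this]
    moreover have False if "d > 0" "\<forall>h>0. h < d \<longrightarrow> ?g 0 < ?g (0 + h)" for d
      using that(1) that(2)[rule_format, of "d / 2"] le[of "d / 2"] by simp
    ultimately have "\<not> 0 < (p - q + real l) * (norm (sgrad u x) / u x) - L"
      by meson
    then show ?thesis by simp
  qed
  then show "norm (sgrad u x) / u x
      \<le> 1 / (p - q + real l) * (SUP y\<in>sphere 0 1. norm (sgrad phi y) / phi y)"
    using beta unfolding L_def[symmetric] by (simp add: field_simps)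
qed

end
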